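(* The assignment $\mathbb K\mapsto\mathcal B(\mathbb K)$, $(\alpha,\beta)\mapsto(\alpha^{\rightarrow},\beta^{\rightarrow})$ is a covariant functor $\mathcal B$ from $\mathbf{Cjm}$ to $\mathbf{CLjm}$, and it induces (under the identifications described in the context) covariant functors - from $\mathbf{Cc}$ to $\mathbf{CLc}$, - from $\mathbf{Ccd}$ to $\mathbf{CLcd}$, - from $\mathbf{Cce}$ to $\mathbf{CLce}$, - from $\mathbf{Cde}$ to $\mathbf{CLis}$, - from $\mathbf{Cc}^*_*$ to $\mathbf{CLc}_*$ and to $\mathbf{CLc}^*$, - from $\mathbf{Cc}^*_*\mathbf d$ to $\mathbf{CLc}_*\mathbf d$ and to $\mathbf{CLc}^*\mathbf d$, - from $\mathbf{Cc}^*_*\mathbf e$ to $\mathbf{CLc}_*\mathbf e$ and to $\mathbf{CLc}^*\mathbf e$. Furthermore, in each of these cases $\mathcal B$ is left adjoint to the functor $\mathcal C$ in the opposite direction. The unit of the adjunctions is $\eta$ (with components $\eta_{\mathbb K}=(\gamma_{\mathbb K},\mu_{\mathbb K}):\mathbb K\to\mathcal C\mathcal B(\mathbb K)$), and the counit is an isomorphism.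
   Context: **Contexts.** A (formal) context is a triple $\mathbb K=(G,M,I)$ with sets $G,M$ and $I\subseteq G\times M$. For $A\subseteq G$, $A^{\uparrow}=\{m\in M: g\,I\,m\ \forall g\in A\}$; for $B\subseteq M$, $B^{\downarrow}=\{g\in G: g\,I\,m\ \forall m\in B\}$; $g^{\uparrow}=\{g\}^{\uparrow}$, $m^{\downarrow}=\{m\}^{\downarrow}$. Extents are the sets $A\subseteq G$ with $A=A^{\uparrow\downarrow}$, intents the sets $B\subseteq M$ with $B=B^{\downarrow\uparrow}$. A concept is a pair $(A,B)$ with $A=B^{\downarrow}$, $B=A^{\uparrow}$. Ordered by $(A,B)\le(C,D)\iff A\subseteq C$, the concepts form a complete lattice $\mathcal B(\mathbb K)$. Put $\gamma_{\mathbb K}(g)=(g^{\uparrow\downarrow},g^{\uparrow})$ and $\mu_{\mathbb K}(m)=(m^{\downarrow},m^{\downarrow\uparrow})$. **Mapping pairs.** A mapping pair $(\alpha,\beta):\mathbb K=(G,M,I)\to\mathbb L=(H,N,J)$ consists of maps $\alpha:G\to H$, $\beta:M\to N$ (composition is componentwise). Images are written $\varphi[\cdot]$, preimages $\varphi^{-}[\cdot]$. The pair is - separately continuous if $\alpha$-preimages of extents are extents and $\beta$-preimages of intents are intents; - conceptual if it is separately continuous and $(A,B)\in\mathcal B(\mathbb K)$ implies $(\beta[B]^{\downarrow},\alpha[A]^{\uparrow})\in\mathcal B(\mathbb L)$; - concept continuous if $(C,D)\in\mathcal B(\mathbb L)$ implies $(\alpha^{-}[C],\beta^{-}[D])\in\mathcal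 B(\mathbb K)$; - an embedding if $g\,I\,m\iff\alpha(g)\,J\,\beta(m)$; - dense if $\alpha$ is extent dense (for each $C\subseteq H$ there is $A\subseteq G$ with $C^{\uparrow\downarrow}=\alpha[A]^{\uparrow\downarrow}$) and $\beta$ is intent dense (for each $D\subseteq N$ there is $B\subseteq M$ with $D^{\downarrow\uparrow}=\beta[B]^{\downarrow\uparrow}$). Lifted maps $\mathcal B(\mathbb K)\to\mathcal B(\mathbb L)$: $\alpha^{\rightarrow}(A,B)=(\alpha[A]^{\uparrow\downarrow},\alpha[A]^{\uparrow})$ and $\beta^{\rightarrow}(A,B)=(\beta[B]^{\downarrow},\beta[B]^{\downarrow\uparrow})$. **Categories of contexts** (objects: all contexts), with morphisms: $\mathbf{Cjm}$ separately continuous pairs; $\mathbf{Cc}$ conceptual pairs; $\mathbf{Ccd}$ dense conceptual pairs; $\mathbf{Cce}$ conceptual embeddings; $\mathbf{Cde}$ dense embeddings; $\mathbf{Cc}^*_*$ concept continuous pairs; $\mathbf{Cc}^*_*\mathbf d$ dense concept continuous pairs; $\mathbf{Cc}^*_*\mathbf e$ concept continuous embeddings. **Categories of complete lattices** (objects: all complete lattices). For a map $\varphi$ between posets, $\varphi^*$ denotes its upper (right) adjoint and $\varphi_*$ its lower (left) adjoint when they exist; $\varphi^{**}=(\varphi^* )^*$, $\varphi_{**}=(\varphi_* )_*$. A map is doubly residuated if it has an upper adjoint which again has an upper adjoint, and doubly residual if it has a lower adjoint which again has a lower adjoint. Complete homomorphisms preserve arbitrary joins and meets. Morphisms: $\mathbf{CLjm}$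 pairs $(\varphi,\psi)$ of maps $K\to L$ with $\varphi$ preserving arbitrary joins and $\psi$ preserving arbitrary meets; $\mathbf{CLc}$ complete homomorphisms; $\mathbf{CLcd}$ surjective complete homomorphisms; $\mathbf{CLce}$ injective complete homomorphisms; $\mathbf{CLis}$ isomorphisms; $\mathbf{CLc}_*$ (resp. $\mathbf{CLc}_*\mathbf d$, $\mathbf{CLc}_*\mathbf e$) doubly residuated maps (resp. surjective, injective ones); $\mathbf{CLc}^*$ (resp. $\mathbf{CLc}^*\mathbf d$, $\mathbf{CLc}^*\mathbf e$) doubly residual maps (resp. surjective, injective ones). **Identifications.** A complete homomorphism $\varphi$ is identified with the pair $(\varphi,\varphi)$ in $\mathbf{CLjm}$, a doubly residuated map $\psi$ with $(\psi,\psi^{**})$, and a doubly residual map $\psi$ with $(\psi_{**},\psi)$. Thus on conceptual pairs $\mathcal B(\alpha,\beta)=\alpha^{\rightarrow}=\beta^{\rightarrow}$; on concept continuous pairs $\mathcal B(\alpha,\beta)=\alpha^{\rightarrow}$ (for $\mathbf{CLc}_*$ and its subcategories) or $\beta^{\rightarrow}$ (for $\mathbf{CLc}^*$ and its subcategories). **The functor $\mathcal C$** sends a complete lattice $(L,\le)$ to the complete context $(L,L,\le)$ and acts identically on mapping pairs (so $\varphi\mapsto(\varphi,\varphi)$ for complete homomorphisms, $\psi\mapsto(\psi,\psi^{**})$ for doubly residuated and $\psi\mapsto(\psi_{**},\psi)$ for doubly residual maps). *)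

theory Defs
  imports "HOL-Algebra.Galois_Connection"
begin

section \<open>Contexts and their concept lattices\<close>

record ('g, 'm) cxt =
  obj :: "'g set"
  att :: "'m set"
  inc :: "('g \<times> 'm) set"

definition is_cxt :: "('g, 'm) cxt \<Rightarrow> bool"
  where "is_cxt K \<longleftrightarrow> inc K \<subseteq> obj K \<times> att K"

definition up :: "('g, 'm) cxt \<Rightarrow> 'g set \<Rightarrow> 'm set"
  where "up K A = {m \<in> att K. \<forall>g\<in>A. (g, m) \<in> inc K}"

definition down :: "('g, 'm) cxt \<Rightarrow> 'm set \<Rightarrow> 'g set"
  where "down K B = {g \<in> obj K. \<forall>m\<in>B. (g, m) \<in> inc K}"

definition extents :: "('g, 'm) cxt \<Rightarrow> 'g set set"
  where "extents K = {A. A \<subseteq> obj K \<and> A = down K (up K A)}"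

definition intents :: "('g, 'm) cxt \<Rightarrow> 'm set set"
  where "intents K = {B. B \<subseteq> att K \<and> B = up K (down K B)}"

definition concepts :: "('g, 'm) cxt \<Rightarrow> ('g set \<times> 'm set) set"
  where "concepts K = {(A, B). A \<subseteq> obj K \<and> B \<subseteq> att K \<and> A = down K B \<and> B = up K A}"

definition concept_lattice :: "('g, 'm) cxt \<Rightarrow> ('g set \<times> 'm set) gorder"
  where "concept_lattice K =
    \<lparr>carrier = concepts K, eq = (=), le = (\<lambda>(A, B) (C, D). A \<subseteq> C)\<rparr>"

definition gam :: "('g, 'm) cxt \<Rightarrow> 'g \<Rightarrow> 'g set \<times> 'm set"
  where "gam K g = (down K (up K {g}), up K {g})"

definition mu :: "('g, 'm) cxt \<Rightarrow> 'm \<Rightarrow> 'g set \<times> 'm set"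
  where "mu K m = (down K {m}, up K (down K {m}))"


section \<open>Mapping pairs and the categories of contexts\<close>

text \<open>
  Maps between carrier sets are extensional functions (value \<open>undefined\<close> outside the domain),
  so that equality of morphisms is equality in HOL.
\<close>

definition mapping_pairs ::
    "('g, 'm) cxt \<Rightarrow> ('h, 'n) cxt \<Rightarrow> (('g \<Rightarrow> 'h) \<times> ('m \<Rightarrow> 'n)) set"
  where "mapping_pairs K L = (obj K \<rightarrow>\<^sub>E obj L) \<times> (att K \<rightarrow>\<^sub>E att L)"

definition separately_continuous ::
    "('g, 'm) cxt \<Rightarrow> ('h, 'n) cxt \<Rightarrow> ('g \<Rightarrow> 'h) \<times> ('m \<Rightarrow> 'n) \<Rightarrow> bool"
  where "separately_continuous K L = (\<lambda>(\<alpha>, \<beta>).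
    (\<forall>C\<in>extents L. {g \<in> obj K. \<alpha> g \<in> C} \<in> extents K) \<and>
    (\<forall>D\<in>intents L. {m \<in> att K. \<beta> m \<in> D} \<in> intents K))"

definition conceptual ::
    "('g, 'm) cxt \<Rightarrow> ('h, 'n) cxt \<Rightarrow> ('g \<Rightarrow> 'h) \<times> ('m \<Rightarrow> 'n) \<Rightarrow> bool"
  where "conceptual K L = (\<lambda>(\<alpha>, \<beta>). separately_continuous K L (\<alpha>, \<beta>) \<and>
    (\<forall>(A, B)\<in>concepts K. (down L (\<beta> ` B), up L (\<alpha> ` A)) \<in> concepts L))"

definition concept_continuous ::
    "('g, 'm) cxt \<Rightarrow> ('h, 'n) cxt \<Rightarrow> ('g \<Rightarrow> 'h) \<times> ('m \<Rightarrow> 'n) \<Rightarrow> bool"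
  where "concept_continuous K L = (\<lambda>(\<alpha>, \<beta>).
    \<forall>(C, D)\<in>concepts L. ({g \<in> obj K. \<alpha> g \<in> C}, {m \<in> att K. \<beta> m \<in> D}) \<in> concepts K)"

definition cxt_embedding ::
    "('g, 'm) cxt \<Rightarrow> ('h, 'n) cxt \<Rightarrow> ('g \<Rightarrow> 'h) \<times> ('m \<Rightarrow> 'n) \<Rightarrow> bool"
  where "cxt_embedding K L = (\<lambda>(\<alpha>, \<beta>).
    \<forall>g\<in>obj K. \<forall>m\<in>att K. (g, m) \<in> inc K \<longleftrightarrow> (\<alpha> g, \<beta> m) \<in> inc L)"

definition extent_dense :: "('g, 'm) cxt \<Rightarrow> ('h, 'n) cxt \<Rightarrow> ('g \<Rightarrow> 'h) \<Rightarrow> bool"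
  where "extent_dense K L \<alpha> \<longleftrightarrow>
    (\<forall>C\<subseteq>obj L. \<exists>A\<subseteq>obj K. down L (up L C) = down L (up L (\<alpha> ` A)))"

definition intent_dense :: "('g, 'm) cxt \<Rightarrow> ('h, 'n) cxt \<Rightarrow> ('m \<Rightarrow> 'n) \<Rightarrow> bool"
  where "intent_dense K L \<beta> \<longleftrightarrow>
    (\<forall>D\<subseteq>att L. \<exists>B\<subseteq>att K. up L (down L D) = up L (down L (\<beta> ` B)))"

definition dense_pair ::
    "('g, 'm) cxt \<Rightarrow> ('h, 'n) cxt \<Rightarrow> ('g \<Rightarrow> 'h) \<times> ('m \<Rightarrow> 'n) \<Rightarrow> bool"
  where "dense_pair K L = (\<lambda>(\<alpha>, \<beta>). extent_dense K L \<alpha> \<and> intent_dense K L \<beta>)"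

text \<open>
  The categories are named by a datatype and their hom-sets given by one polymorphic function of
  the name. This lets a statement quantify over the categories while using the hom-sets at several
  different carrier types. \<open>Ccc\<close> stands for the category of concept continuous pairs.
\<close>

datatype cxt_cat = Cjm | Cc | Ccd | Cce | Cde | Ccc | Cccd | Ccce

primrec cxt_hom ::
    "cxt_cat \<Rightarrow> ('g, 'm) cxt \<Rightarrow> ('h, 'n) cxt \<Rightarrow> (('g \<Rightarrow> 'h) \<times> ('m \<Rightarrow> 'n)) set"
  where
    "cxt_hom Cjm K L = {f \<in> mapping_pairs K L. separately_continuous K L f}"
  | "cxt_hom Cc K L = {f \<in> mapping_pairs K L. conceptual K L f}"
  | "cxt_hom Ccd K L = {f \<in> mapping_pairs K L. dense_pair K L f \<and> conceptual K L f}"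
  | "cxt_hom Cce K L = {f \<in> mapping_pairs K L. conceptual K L f \<and> cxt_embedding K L f}"
  | "cxt_hom Cde K L = {f \<in> mapping_pairs K L. dense_pair K L f \<and> cxt_embedding K L f}"
  | "cxt_hom Ccc K L = {f \<in> mapping_pairs K L. concept_continuous K L f}"
  | "cxt_hom Cccd K L = {f \<in> mapping_pairs K L. dense_pair K L f \<and> concept_continuous K L f}"
  | "cxt_hom Ccce K L = {f \<in> mapping_pairs K L. concept_continuous K L f \<and> cxt_embedding K L f}"

definition cxt_id :: "('g, 'm) cxt \<Rightarrow> ('g \<Rightarrow> 'g) \<times> ('m \<Rightarrow> 'm)"
  where "cxt_id K = (\<lambda>g\<in>obj K. g, \<lambda>m\<in>att K. m)"

text \<open>\<open>cxt_comp K f' f\<close> is \<open>f'\<close> after \<open>f\<close>, where \<open>K\<close> is the domain of \<open>f\<close>.\<close>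

definition cxt_comp :: "('g, 'm) cxt \<Rightarrow> ('h \<Rightarrow> 'k) \<times> ('n \<Rightarrow> 'o) \<Rightarrow>
    ('g \<Rightarrow> 'h) \<times> ('m \<Rightarrow> 'n) \<Rightarrow> ('g \<Rightarrow> 'k) \<times> ('m \<Rightarrow> 'o)"
  where "cxt_comp K f' f = (compose (obj K) (fst f') (fst f), compose (att K) (snd f') (snd f))"


section \<open>The categories of complete lattices\<close>

text \<open>The upper adjoint \<open>\<phi>\<^sup>*\<close> of \<open>\<phi> : K \<rightarrow> L\<close>, respectively the lower adjoint \<open>\<psi>\<^sub>*\<close> of \<open>\<psi> : K \<rightarrow> L\<close>;
  meaningful only if the adjoint exists, and then unique.\<close>

definition upper_adj :: "'a gorder \<Rightarrow> 'b gorder \<Rightarrow> ('a \<Rightarrow> 'b) \<Rightarrow> 'b \<Rightarrow> 'a"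
  where "upper_adj K L \<phi> = (THE \<chi>. \<chi> \<in> carrier L \<rightarrow>\<^sub>E carrier K \<and>
    galois_connection \<lparr>orderA = K, orderB = L, lower = \<phi>, upper = \<chi>\<rparr>)"

definition lower_adj :: "'a gorder \<Rightarrow> 'b gorder \<Rightarrow> ('a \<Rightarrow> 'b) \<Rightarrow> 'b \<Rightarrow> 'a"
  where "lower_adj K L \<psi> = (THE \<chi>. \<chi> \<in> carrier L \<rightarrow>\<^sub>E carrier K \<and>
    galois_connection \<lparr>orderA = L, orderB = K, lower = \<chi>, upper = \<psi>\<rparr>)"

definition complete_homs :: "'a gorder \<Rightarrow> 'b gorder \<Rightarrow> ('a \<Rightarrow> 'b) set"
  where "complete_homs K L =
    {\<phi> \<in> carrier K \<rightarrow>\<^sub>E carrier L. sup_pres K L \<phi> \<and> inf_pres K L \<phi>}"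

definition lattice_isos :: "'a gorder \<Rightarrow> 'b gorder \<Rightarrow> ('a \<Rightarrow> 'b) set"
  where "lattice_isos K L =
    {\<phi> \<in> carrier K \<rightarrow>\<^sub>E carrier L. bij_betw \<phi> (carrier K) (carrier L) \<and> order_emb K L \<phi>}"

definition doubly_residuated :: "'a gorder \<Rightarrow> 'b gorder \<Rightarrow> ('a \<Rightarrow> 'b) set"
  where "doubly_residuated K L = {\<phi> \<in> carrier K \<rightarrow>\<^sub>E carrier L.
    lower_adjoint K L \<phi> \<and> lower_adjoint L K (upper_adj K L \<phi>)}"

text \<open>The library's \<open>upper_adjoint L K \<psi>\<close> says that \<open>\<psi> : K \<rightarrow> L\<close> has a lower adjoint.\<close>

definition doubly_residual :: "'a gorder \<Rightarrow> 'b gorder \<Rightarrow> ('a \<Rightarrow> 'b) set"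
  where "doubly_residual K L = {\<psi> \<in> carrier K \<rightarrow>\<^sub>E carrier L.
    upper_adjoint L K \<psi> \<and> upper_adjoint K L (lower_adj K L \<psi>)}"

definition surj_maps :: "'a gorder \<Rightarrow> 'b gorder \<Rightarrow> ('a \<Rightarrow> 'b) set"
  where "surj_maps K L = {\<phi>. \<phi> ` carrier K = carrier L}"

definition inj_maps :: "'a gorder \<Rightarrow> ('a \<Rightarrow> 'b) set"
  where "inj_maps K = {\<phi>. inj_on \<phi> (carrier K)}"

text \<open>The identifications of single maps with pairs of maps: \<open>\<phi>\<close> with \<open>(\<phi>, \<phi>)\<close>, \<open>\<psi>\<close> with
  \<open>(\<psi>, \<psi>\<^sup>*\<^sup>*)\<close>, and \<open>\<psi>\<close> with \<open>(\<psi>\<^sub>*\<^sub>*, \<psi>)\<close>.\<close>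

definition pair_hom :: "('a \<Rightarrow> 'b) \<Rightarrow> ('a \<Rightarrow> 'b) \<times> ('a \<Rightarrow> 'b)"
  where "pair_hom \<phi> = (\<phi>, \<phi>)"

definition pair_residuated ::
    "'a gorder \<Rightarrow> 'b gorder \<Rightarrow> ('a \<Rightarrow> 'b) \<Rightarrow> ('a \<Rightarrow> 'b) \<times> ('a \<Rightarrow> 'b)"
  where "pair_residuated K L \<psi> = (\<psi>, upper_adj L K (upper_adj K L \<psi>))"

definition pair_residual ::
    "'a gorder \<Rightarrow> 'b gorder \<Rightarrow> ('a \<Rightarrow> 'b) \<Rightarrow> ('a \<Rightarrow> 'b) \<times> ('a \<Rightarrow> 'b)"
  where "pair_residual K L \<psi> = (lower_adj L K (lower_adj K L \<psi>), \<psi>)"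

text \<open>\<open>CLc_low\<close> and \<open>CLc_up\<close> (with suffixes \<open>d\<close>, \<open>e\<close>) stand for the categories of doubly
  residuated, respectively doubly residual, maps.\<close>

datatype lat_cat = CLjm | CLc | CLcd | CLce | CLis
  | CLc_low | CLc_low_d | CLc_low_e | CLc_up | CLc_up_d | CLc_up_e

primrec lat_hom ::
    "lat_cat \<Rightarrow> 'a gorder \<Rightarrow> 'b gorder \<Rightarrow> (('a \<Rightarrow> 'b) \<times> ('a \<Rightarrow> 'b)) set"
  where
    "lat_hom CLjm K L = {\<phi> \<in> carrier K \<rightarrow>\<^sub>E carrier L. sup_pres K L \<phi>} \<times>
       {\<psi> \<in> carrier K \<rightarrow>\<^sub>E carrier L. inf_pres K L \<psi>}"
  | "lat_hom CLc K L = pair_hom ` complete_homs K L"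
  | "lat_hom CLcd K L = pair_hom ` (complete_homs K L \<inter> surj_maps K L)"
  | "lat_hom CLce K L = pair_hom ` (complete_homs K L \<inter> inj_maps K)"
  | "lat_hom CLis K L = pair_hom ` lattice_isos K L"
  | "lat_hom CLc_low K L = pair_residuated K L ` doubly_residuated K L"
  | "lat_hom CLc_low_d K L = pair_residuated K L ` (doubly_residuated K L \<inter> surj_maps K L)"
  | "lat_hom CLc_low_e K L = pair_residuated K L ` (doubly_residuated K L \<inter> inj_maps K)"
  | "lat_hom CLc_up K L = pair_residual K L ` doubly_residual K L"
  | "lat_hom CLc_up_d K L = pair_residual K L ` (doubly_residual K L \<inter> surj_maps K L)"
  | "lat_hom CLc_up_e K L = pair_residual K L ` (doubly_residual K L \<inter> inj_maps K)"

definition lat_id :: "'a gorder \<Rightarrow> ('a \<Rightarrow> 'a) \<times> ('a \<Rightarrow> 'a)"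
  where "lat_id L = (\<lambda>x\<in>carrier L. x, \<lambda>x\<in>carrier L. x)"

definition lat_comp :: "'a gorder \<Rightarrow> ('b \<Rightarrow> 'c) \<times> ('b \<Rightarrow> 'c) \<Rightarrow>
    ('a \<Rightarrow> 'b) \<times> ('a \<Rightarrow> 'b) \<Rightarrow> ('a \<Rightarrow> 'c) \<times> ('a \<Rightarrow> 'c)"
  where "lat_comp L h' h =
    (compose (carrier L) (fst h') (fst h), compose (carrier L) (snd h') (snd h))"

definition lat_cat_iso ::
    "lat_cat \<Rightarrow> 'a gorder \<Rightarrow> 'b gorder \<Rightarrow> ('a \<Rightarrow> 'b) \<times> ('a \<Rightarrow> 'b) \<Rightarrow> bool"
  where "lat_cat_iso Y K L h \<longleftrightarrow> h \<in> lat_hom Y K L \<and>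
    (\<exists>h'\<in>lat_hom Y L K. lat_comp K h' h = lat_id K \<and> lat_comp L h h' = lat_id L)"


section \<open>The functors, the unit and the counit\<close>

definition Bmor :: "('g, 'm) cxt \<Rightarrow> ('h, 'n) cxt \<Rightarrow> ('g \<Rightarrow> 'h) \<times> ('m \<Rightarrow> 'n) \<Rightarrow>
    ('g set \<times> 'm set \<Rightarrow> 'h set \<times> 'n set) \<times> ('g set \<times> 'm set \<Rightarrow> 'h set \<times> 'n set)"
  where "Bmor K L = (\<lambda>(\<alpha>, \<beta>).
    (\<lambda>(A, B)\<in>concepts K. (down L (up L (\<alpha> ` A)), up L (\<alpha> ` A)),
     \<lambda>(A, B)\<in>concepts K. (down L (\<beta> ` B), up L (down L (\<beta> ` B)))))"

definition complete_cxt :: "'a gorder \<Rightarrow> ('a, 'a) cxt"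
  where "complete_cxt L = \<lparr>obj = carrier L, att = carrier L,
    inc = {(x, y). x \<in> carrier L \<and> y \<in> carrier L \<and> x \<sqsubseteq>\<^bsub>L\<^esub> y}\<rparr>"

definition Cmor :: "('a \<Rightarrow> 'b) \<times> ('a \<Rightarrow> 'b) \<Rightarrow> ('a \<Rightarrow> 'b) \<times> ('a \<Rightarrow> 'b)"
  where "Cmor h = h"

definition eta :: "('g, 'm) cxt \<Rightarrow>
    ('g \<Rightarrow> 'g set \<times> 'm set) \<times> ('m \<Rightarrow> 'g set \<times> 'm set)"
  where "eta K = (\<lambda>g\<in>obj K. gam K g, \<lambda>m\<in>att K. mu K m)"

text \<open>The component at \<open>L\<close> of the counit: the morphism corresponding to the identity of
  \<open>complete_cxt L\<close> under the adjunction with unit \<open>eta\<close>.\<close>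

definition counit :: "lat_cat \<Rightarrow> 'a gorder \<Rightarrow>
    ('a set \<times> 'a set \<Rightarrow> 'a) \<times> ('a set \<times> 'a set \<Rightarrow> 'a)"
  where "counit Y L = (THE e. e \<in> lat_hom Y (concept_lattice (complete_cxt L)) L \<and>
    cxt_comp (complete_cxt L) (Cmor e) (eta (complete_cxt L)) = cxt_id (complete_cxt L))"

end

(*
  A pair of maps between complete lattices is a morphism of one of the lattice categories exactly if
  it is a morphism of the corresponding context category between the complete contexts, so the
  lattice categories are full subcategories of the context categories.  The preimage map of a
  concept continuous pair is at once the upper adjoint of the lifted object map and the lower adjoint
  of the lifted attribute map, which accounts for the doubly residuated and doubly residual maps.
  The unit is an epimorphism for continuous pairs into complete contexts, because every concept is a
  join of object concepts and a meet of attribute concepts.  For a complete context the unit is an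
  isomorphism, and its inverse, the join of the extent, is the counit; functoriality, the triangle
  identities and naturality then follow by comparing composites with the unit.
*)

theory Submission
  imports Defs
begin

section \<open>Polarities of a context\<close>

text \<open>The eleven cases share one argument: the main steps hold for an arbitrary
  \<open>X\<close>, and the eight hom-conditions are separated only by a closing case distinction.
  Uniqueness arguments use separate continuity alone, so they need every hom-set to lie in that of
  \<open>Cjm\<close>. The case that resists is \<open>Cde\<close>, whose definition has no
  continuity condition; there density supplies the sets from which preimages of concepts are
  computed. Membership of the counit in every hom-set is settled at one stroke, because a lattice
  isomorphism meets all eight conditions.

  Contexts and lattices are linked by residuation: a map between complete lattices preserves joins
  exactly if preimages of principal ideals are principal, and the principal ideals are the extents
  of the complete context. Concept continuity asks in addition that the preimages of an ideal and of
  the corresponding filter have the same generator. This common generator, as a function of the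
  given element, is the middle map of an adjoint string.\<close>

lemma up_subset: "up K A \<subseteq> att K"
  and down_subset: "down K B \<subseteq> obj K"
  by (auto simp: up_def down_def)

lemma up_antimono: "A \<subseteq> A' \<Longrightarrow> up K A' \<subseteq> up K A"
  and down_antimono: "B \<subseteq> B' \<Longrightarrow> down K B' \<subseteq> down K B"
  by (auto simp: up_def down_def)

lemma subset_down_iff: "A \<subseteq> obj K \<Longrightarrow> B \<subseteq> att K \<Longrightarrow> A \<subseteq> down K B \<longleftrightarrow> B \<subseteq> up K A"
  by (auto simp: up_def down_def)

lemma subset_down_up: "A \<subseteq> obj K \<Longrightarrow> A \<subseteq> down K (up K A)"
  and subset_up_down: "B \<subseteq> att K \<Longrightarrow> B \<subseteq> up K (down K B)"
  by (auto simp: up_def down_def)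

lemma up_down_up [simp]: "A \<subseteq> obj K \<Longrightarrow> up K (down K (up K A)) = up K A"
  by (intro equalityI up_antimono subset_down_up subset_up_down up_subset)

lemma down_up_down [simp]: "B \<subseteq> att K \<Longrightarrow> down K (up K (down K B)) = down K B"
  by (intro equalityI down_antimono subset_down_up subset_up_down down_subset)

text \<open>The closure of \<open>A\<close> is the least extent above it, so inclusion in an extent
  is tested on generators. Inequalities about lifted maps thereby become inclusions between sets of
  objects.\<close>

lemma down_up_subset_iff:
  assumes "A \<subseteq> obj K" "B \<subseteq> att K"
  shows "down K (up K A) \<subseteq> down K B \<longleftrightarrow> A \<subseteq> down K B"
  using assms subset_down_iff[of A K B] subset_down_iff[of "down K (up K A)" K B] down_subset
  by fastforce

lemma up_down_subset_iff:
  assumes "A \<subseteq> obj K" "B \<subseteq> att K"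
  shows "up K (down K B) \<subseteq> up K A \<longleftrightarrow> B \<subseteq> up K A"
  using assms subset_down_iff[of A K B] subset_down_iff[of A K "up K (down K B)"] up_subset
  by fastforce

lemma conceptD:
  assumes "(A, B) \<in> concepts K"
  shows "A \<subseteq> obj K" "B \<subseteq> att K" "down K B = A" "up K A = B"
  using assms unfolding concepts_def by blast+

lemma concept_up [intro, simp]: "A \<subseteq> obj K \<Longrightarrow> (down K (up K A), up K A) \<in> concepts K"
  and concept_down [intro, simp]: "B \<subseteq> att K \<Longrightarrow> (down K B, up K (down K B)) \<in> concepts K"
  by (simp_all add: concepts_def up_subset down_subset)

text \<open>Together with \<open>intents_eq\<close> this lets preimage conditions range over
  concepts, which in a complete context are indexed by lattice elements.\<close>

lemma extents_eq: "extents K = fst ` concepts K"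
proof (intro equalityI subsetI)
  fix A assume "A \<in> extents K"
  then have "(A, up K A) \<in> concepts K"
    by (auto simp: extents_def concepts_def up_subset)
  then show "A \<in> fst ` concepts K"
    by force
qed (auto simp: extents_def concepts_def)

lemma intents_eq: "intents K = snd ` concepts K"
proof (intro equalityI subsetI)
  fix B assume "B \<in> intents K"
  then have "(down K B, B) \<in> concepts K"
    by (auto simp: intents_def concepts_def down_subset)
  then show "B \<in> snd ` concepts K"
    by force
qed (auto simp: intents_def concepts_def)

lemma concept_eqI:
  assumes "x \<in> concepts K" "y \<in> concepts K" "fst x = fst y"
  shows "x = y"
  using assms by (auto simp: concepts_def)

lemma concept_subset_iff:
  assumes "(A, B) \<in> concepts K" "(C, D) \<in> concepts K"
  shows "A \<subseteq> C \<longleftrightarrow> D \<subseteq> B"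
  using conceptD[OF assms(1)] conceptD[OF assms(2)] by (metis subset_down_iff)

section \<open>The concept lattice\<close>

lemma carrier_concept_lattice [simp]: "carrier (concept_lattice K) = concepts K"
  and le_concept_lattice: "x \<sqsubseteq>\<^bsub>concept_lattice K\<^esub> y \<longleftrightarrow> fst x \<subseteq> fst y"
  by (simp_all add: concept_lattice_def split_beta)

lemma le_concept_lattice_snd:
  "x \<in> concepts K \<Longrightarrow> y \<in> concepts K \<Longrightarrow> x \<sqsubseteq>\<^bsub>concept_lattice K\<^esub> y \<longleftrightarrow> snd y \<subseteq> snd x"
  by (cases x; cases y) (simp add: le_concept_lattice concept_subset_iff)

lemma partial_order_concept_lattice: "partial_order (concept_lattice K)"
  by unfold_locales (auto simp: concept_lattice_def concepts_def)

text \<open>Joins close the union of the extents. Meets close the union of the intents instead of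
  intersecting the extents, so the second half mirrors the first under the polarity.\<close>

lemma complete_lattice_concept_lattice: "complete_lattice (concept_lattice K)"
proof (rule partial_order.complete_latticeI[OF partial_order_concept_lattice])
  fix S assume "S \<subseteq> carrier (concept_lattice K)"
  then have S: "S \<subseteq> concepts K"
    by simp
  let ?A = "\<Union>(fst ` S)" and ?B = "\<Union>(snd ` S)"
  have A: "?A \<subseteq> obj K" and B: "?B \<subseteq> att K"
    using S by (fastforce dest: conceptD(1,2))+
  have "least (concept_lattice K) (down K (up K ?A), up K ?A) (Upper (concept_lattice K) S)"
  proof (rule least_UpperI)
    show "x \<sqsubseteq>\<^bsub>concept_lattice K\<^esub> (down K (up K ?A), up K ?A)" if "x \<in> S" for x
      using that subset_down_up[OF A] by (auto simp: le_concept_lattice)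
    show "(down K (up K ?A), up K ?A) \<sqsubseteq>\<^bsub>concept_lattice K\<^esub> y"
      if "y \<in> Upper (concept_lattice K) S" for y
    proof -
      have y: "y \<in> concepts K"
        using that by (simp add: Upper_def)
      have *: "\<And>x. x \<in> S \<Longrightarrow> fst x \<subseteq> fst y"
        using Upper_memD[of y "concept_lattice K" S] that S by (simp add: le_concept_lattice)
      have "fst y = down K (snd y)" "snd y \<subseteq> att K"
        using y conceptD[of "fst y" "snd y" K] by auto
      moreover have "?A \<subseteq> fst y"
        by (intro Union_least) (use * in auto)
      ultimately show ?thesis
        using down_up_subset_iff[OF A, of "snd y"] by (simp add: le_concept_lattice)
    qed
  qed (use S A in auto)
  then show "\<exists>s. least (concept_lattice K) s (Upper (concept_lattice K) S)" ..
  have "greatest (concept_lattice K) (down K ?B, up K (down K ?B)) (Lower (concept_lattice K) S)"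
  proof (rule greatest_LowerI)
    show "(down K ?B, up K (down K ?B)) \<sqsubseteq>\<^bsub>concept_lattice K\<^esub> x" if "x \<in> S" for x
      using that S subset_up_down[OF B] B
      by (subst le_concept_lattice_snd) (auto simp del: concept_down intro!: concept_down)
    show "y \<sqsubseteq>\<^bsub>concept_lattice K\<^esub> (down K ?B, up K (down K ?B))"
      if "y \<in> Lower (concept_lattice K) S" for y
    proof -
      have y: "y \<in> concepts K"
        using that by (simp add: Lower_def)
      then have "snd y = up K (fst y)" "fst y \<subseteq> obj K"
        using conceptD[of "fst y" "snd y" K] by auto
      moreover have "snd x \<subseteq> snd y" if "x \<in> S" for x
        using Lower_memD[OF \<open>y \<in> Lower _ _\<close> that] le_concept_lattice_snd[of y K x] subsetD[OF S that] S y
        by simp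
      then have "?B \<subseteq> snd y"
        by (intro Union_least) auto
      ultimately show ?thesis
        using y B up_down_subset_iff[of "fst y", OF _ B] by (subst le_concept_lattice_snd) auto
    qed
  qed (use S B in auto)
  then show "\<exists>i. greatest (concept_lattice K) i (Lower (concept_lattice K) S)" ..
qed

section \<open>Morphisms of contexts\<close>

lemma mapping_pairsD:
  assumes "(\<alpha>, \<beta>) \<in> mapping_pairs K L"
  shows "A \<subseteq> obj K \<Longrightarrow> \<alpha> ` A \<subseteq> obj L" "B \<subseteq> att K \<Longrightarrow> \<beta> ` B \<subseteq> att L"
  using assms by (auto simp: mapping_pairs_def)

text \<open>The preimage of the closure of \<alpha>[A] is an extent containing \<open>A\<close>,
  hence it contains the closure of \<open>A\<close>. So a separately continuous pair sees a set only
  up to closure.\<close>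

lemma separately_continuous_up:
  assumes f: "(\<alpha>, \<beta>) \<in> mapping_pairs K L" "separately_continuous K L (\<alpha>, \<beta>)" and A: "A \<subseteq> obj K"
  shows "up L (\<alpha> ` down K (up K A)) = up L (\<alpha> ` A)"
proof (rule equalityI)
  show "up L (\<alpha> ` down K (up K A)) \<subseteq> up L (\<alpha> ` A)"
    by (intro up_antimono image_mono subset_down_up A)
  let ?E = "down L (up L (\<alpha> ` A))"
  have aA: "\<alpha> ` A \<subseteq> obj L"
    using f(1) A by (rule mapping_pairsD)
  let ?P = "{g \<in> obj K. \<alpha> g \<in> ?E}"
  have "?E \<in> extents L"
    using aA by (simp add: extents_def down_subset)
  then have P: "down K (up K ?P) = ?P"
    using f(2) by (auto simp: separately_continuous_def extents_def)
  have "A \<subseteq> ?P"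
    using A subset_down_up[OF aA] by auto
  then have "down K (up K A) \<subseteq> ?P"
    using down_antimono[OF up_antimono[of A ?P K], of K] P by simp
  then have "\<alpha> ` down K (up K A) \<subseteq> ?E"
    by auto
  from up_antimono[OF this, of L] show "up L (\<alpha> ` A) \<subseteq> up L (\<alpha> ` down K (up K A))"
    using aA by simp
qed

lemma separately_continuous_down:
  assumes f: "(\<alpha>, \<beta>) \<in> mapping_pairs K L" "separately_continuous K L (\<alpha>, \<beta>)" and B: "B \<subseteq> att K"
  shows "down L (\<beta> ` up K (down K B)) = down L (\<beta> ` B)"
proof (rule equalityI)
  show "down L (\<beta> ` up K (down K B)) \<subseteq> down L (\<beta> ` B)"
    by (intro down_antimono image_mono subset_up_down B)
  let ?E = "up L (down L (\<beta> ` B))"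
  have bB: "\<beta> ` B \<subseteq> att L"
    using f(1) B by (rule mapping_pairsD)
  let ?P = "{m \<in> att K. \<beta> m \<in> ?E}"
  have "?E \<in> intents L"
    using bB by (simp add: intents_def up_subset)
  then have P: "up K (down K ?P) = ?P"
    using f(2) by (auto simp: separately_continuous_def intents_def)
  have "B \<subseteq> ?P"
    using B subset_up_down[OF bB] by auto
  then have "up K (down K B) \<subseteq> ?P"
    using up_antimono[OF down_antimono[of B ?P K], of K] P by simp
  then have "\<beta> ` up K (down K B) \<subseteq> ?E"
    by auto
  from down_antimono[OF this, of L] show "down L (\<beta> ` B) \<subseteq> down L (\<beta> ` up K (down K B))"
    using bB by simp
qed

lemma concept_continuous_imp_separately_continuous:
  assumes "concept_continuous K L f"
  shows "separately_continuous K L f"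
  using assms unfolding concept_continuous_def separately_continuous_def extents_eq intents_eq
  by (force simp: split_beta)

text \<open>Density writes \<open>D\<close> as a polar of \<alpha>[A] and \<open>C\<close> as a
  polar of \<beta>[B]. The embedding pulls these polars back, so the preimages are
  \<open>down K B\<close> and \<open>up K A\<close>, and only their mutual polarity is left to
  check.\<close>

lemma dense_embedding_imp_concept_continuous:
  assumes f: "(\<alpha>, \<beta>) \<in> mapping_pairs K L"
    and "dense_pair K L (\<alpha>, \<beta>)" and emb: "cxt_embedding K L (\<alpha>, \<beta>)"
  shows "concept_continuous K L (\<alpha>, \<beta>)"
  unfolding concept_continuous_def
proof clarsimp
  fix C D assume CD: "(C, D) \<in> concepts L"
  note c = conceptD[OF CD]
  obtain A where A: "A \<subseteq> obj K" "down L (up L C) = down L (up L (\<alpha> ` A))"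
    using assms(2) c(1) unfolding dense_pair_def extent_dense_def by blast
  obtain B where B: "B \<subseteq> att K" "up L (down L D) = up L (down L (\<beta> ` B))"
    using assms(2) c(2) unfolding dense_pair_def intent_dense_def by blast
  note ab = mapping_pairsD(1)[OF f A(1)] mapping_pairsD(2)[OF f B(1)]
  \<comment> \<open>The polarity crosses sides: density at the extent \<open>C\<close> describes the
    intent \<open>D\<close>, and density at \<open>D\<close> describes \<open>C\<close>.\<close>
  have D: "D = up L (\<alpha> ` A)"
    using A(2) c ab by (metis up_down_up)
  have C: "C = down L (\<beta> ` B)"
    using B(2) c ab by (metis down_up_down)
  have PC: "{g \<in> obj K. \<alpha> g \<in> C} = down K B"
    using emb f B(1) unfolding C cxt_embedding_def mapping_pairs_def by (auto simp: down_def subset_iff)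
  have PD: "{m \<in> att K. \<beta> m \<in> D} = up K A"
    using emb f A(1) unfolding D cxt_embedding_def mapping_pairs_def by (auto simp: up_def subset_iff)
  have AC: "A \<subseteq> down K B"
    using A(1) subset_down_up[OF ab(1)] c(3) D C PC by blast
  have BD: "B \<subseteq> up K A"
    using B(1) subset_up_down[OF ab(2)] c(4) D C PD by blast
  \<comment> \<open>All of \<open>C\<close> is incident with all of \<open>D\<close>, and the
    embedding reflects this to the preimages. It gives one half of the polarity equations;
    \<open>AC\<close> and \<open>BD\<close> give the other.\<close>
  have "(g, m) \<in> inc K" if "g \<in> down K B" "m \<in> up K A" for g m
  proof -
    have "\<alpha> g \<in> C" "\<beta> m \<in> D" "g \<in> obj K" "m \<in> att K"
      using that PC PD by auto
    then show ?thesis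
      using emb c(3) by (auto simp: cxt_embedding_def down_def)
  qed
  then have "up K A \<subseteq> up K (down K B)" "down K B \<subseteq> down K (up K A)"
    by (auto simp: up_def down_def)
  moreover have "up K (down K B) \<subseteq> up K A" "down K (up K A) \<subseteq> down K B"
    by (rule up_antimono[OF AC], rule down_antimono[OF BD])
  ultimately show "({g \<in> obj K. \<alpha> g \<in> C}, {m \<in> att K. \<beta> m \<in> D}) \<in> concepts K"
    unfolding PC PD by (auto simp: concepts_def up_subset down_subset subset_antisym)
qed

text \<open>Makes separate continuity available for every \<open>X\<close>. Only \<open>Cde\<close>
  has it neither as a condition nor through conceptuality or concept continuity; there it follows
  from density and embedding.\<close>

lemma cxt_hom_imp_Cjm:
  assumes "f \<in> cxt_hom X K L"
  shows "f \<in> cxt_hom Cjm K L"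
proof -
  have "separately_continuous K L f" if "f \<in> mapping_pairs K L" "dense_pair K L f" "cxt_embedding K L f"
    using that
    by (cases f) (simp add: dense_embedding_imp_concept_continuous concept_continuous_imp_separately_continuous)
  moreover have "separately_continuous K L f" if "conceptual K L f"
    using that by (simp add: conceptual_def split_beta)
  ultimately show ?thesis
    using assms by (cases X) (auto intro: concept_continuous_imp_separately_continuous)
qed

lemma cxt_id_in_hom: "cxt_id K \<in> cxt_hom X K K"
proof -
  have m: "cxt_id K \<in> mapping_pairs K K"
    by (auto simp: cxt_id_def mapping_pairs_def)
  have e: "cxt_embedding K K (cxt_id K)"
    by (auto simp: cxt_id_def cxt_embedding_def)
  have "restrict (\<lambda>g. g) (obj K) ` A = A" if "A \<subseteq> obj K" for A
    using that by (force simp: restrict_def image_iff)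
  moreover have "restrict (\<lambda>m. m) (att K) ` B = B" if "B \<subseteq> att K" for B
    using that by (force simp: restrict_def image_iff)
  ultimately have id: "\<And>A. A \<subseteq> obj K \<Longrightarrow> fst (cxt_id K) ` A = A" "\<And>B. B \<subseteq> att K \<Longrightarrow> snd (cxt_id K) ` B = B"
    by (simp_all add: cxt_id_def)
  have d: "dense_pair K K (cxt_id K)"
    unfolding dense_pair_def split_beta extent_dense_def intent_dense_def using id by metis
  \<comment> \<open>The identity is a dense embedding, which already yields concept
    continuity.\<close>
  have cc: "concept_continuous K K (cxt_id K)"
    using dense_embedding_imp_concept_continuous m d e by (cases "cxt_id K") simp
  have "conceptual K K (cxt_id K)"
    unfolding conceptual_def split_beta prod.collapse
    using concept_continuous_imp_separately_continuous[OF cc] id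
    by (auto dest: conceptD simp: conceptD)
  with m e d cc show ?thesis
    by (cases X) (auto intro: concept_continuous_imp_separately_continuous)
qed

text \<open>Preimage conditions and embeddings compose directly. Density and conceptuality control
  the middle context only up to closure, so there the second pair must ignore closures, which its
  separate continuity provides.\<close>

lemma cxt_comp_in_hom:
  assumes "f \<in> cxt_hom X K K'" "f' \<in> cxt_hom X K' K''"
  shows "cxt_comp K f' f \<in> cxt_hom X K K''"
proof -
  obtain \<alpha> \<beta> \<alpha>' \<beta>' where f: "f = (\<alpha>, \<beta>)" "f' = (\<alpha>', \<beta>')"
    by fastforce
  let ?g = "cxt_comp K f' f"
  have m: "(\<alpha>, \<beta>) \<in> mapping_pairs K K'" "(\<alpha>', \<beta>') \<in> mapping_pairs K' K''"
    and s: "separately_continuous K K' (\<alpha>, \<beta>)" "separately_continuous K' K'' (\<alpha>', \<beta>')"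
    using assms[THEN cxt_hom_imp_Cjm] by (auto simp: f)
  have g: "?g \<in> mapping_pairs K K''"
    using m by (auto simp: cxt_comp_def f mapping_pairs_def compose_def)
  have im: "\<And>A. A \<subseteq> obj K \<Longrightarrow> fst ?g ` A = \<alpha>' ` \<alpha> ` A" "\<And>B. B \<subseteq> att K \<Longrightarrow> snd ?g ` B = \<beta>' ` \<beta> ` B"
    by (force simp: cxt_comp_def f compose_def image_iff)+
  have pre: "{g \<in> obj K. fst ?g g \<in> C} = {g \<in> obj K. \<alpha> g \<in> {g \<in> obj K'. \<alpha>' g \<in> C}}"
    "{m \<in> att K. snd ?g m \<in> D} = {m \<in> att K. \<beta> m \<in> {m \<in> att K'. \<beta>' m \<in> D}}" for C D
    using m by (auto simp: cxt_comp_def f compose_def mapping_pairs_def)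
  have sc: "separately_continuous K K'' ?g"
    using s unfolding separately_continuous_def split_beta pre fst_conv snd_conv by blast
  have cc: "concept_continuous K K'' ?g"
    if "concept_continuous K K' f" "concept_continuous K' K'' f'"
    unfolding concept_continuous_def split_beta pre
  proof
    fix x assume "x \<in> concepts K''"
    then have "({g \<in> obj K'. \<alpha>' g \<in> fst x}, {m \<in> att K'. \<beta>' m \<in> snd x}) \<in> concepts K'"
      using that(2) unfolding concept_continuous_def f split_beta fst_conv snd_conv by blast
    from bspec[OF that(1)[unfolded concept_continuous_def f split_beta fst_conv snd_conv] this]
    show "({g \<in> obj K. \<alpha> g \<in> {g \<in> obj K'. \<alpha>' g \<in> fst x}},
        {m \<in> att K. \<beta> m \<in> {m \<in> att K'. \<beta>' m \<in> snd x}}) \<in> concepts K"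
      unfolding fst_conv snd_conv .
  qed
  have e: "cxt_embedding K K'' ?g" if "cxt_embedding K K' f" "cxt_embedding K' K'' f'"
  proof -
    have "\<And>g. g \<in> obj K \<Longrightarrow> \<alpha> g \<in> obj K'" "\<And>m. m \<in> att K \<Longrightarrow> \<beta> m \<in> att K'"
      using m(1) by (auto simp: mapping_pairs_def)
    then show ?thesis
      using that by (simp add: cxt_embedding_def cxt_comp_def f compose_def)
  qed
  have d: "dense_pair K K'' ?g" if "dense_pair K K' f" "dense_pair K' K'' f'"
  proof -
    have "\<exists>A\<subseteq>obj K. down K'' (up K'' C) = down K'' (up K'' (fst ?g ` A))" if C: "C \<subseteq> obj K''" for C
    proof -
      obtain A' where A': "A' \<subseteq> obj K'" "down K'' (up K'' C) = down K'' (up K'' (\<alpha>' ` A'))"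
        using \<open>dense_pair K' K'' f'\<close> C unfolding dense_pair_def extent_dense_def f by auto
      obtain A where A: "A \<subseteq> obj K" "down K' (up K' A') = down K' (up K' (\<alpha> ` A))"
        using \<open>dense_pair K K' f\<close> A' unfolding dense_pair_def extent_dense_def f by auto
      \<comment> \<open>\<open>A'\<close> need not be an image under \<alpha>; it only has the same
        closure as \<alpha>[A], and the outer map cannot tell the two apart after taking upper
        polars.\<close>
      have "up K'' (\<alpha>' ` \<alpha> ` A) = up K'' (\<alpha>' ` A')"
        using A A'(1) mapping_pairsD(1)[OF m(1) A(1)] separately_continuous_up[OF m(2) s(2)] by metis
      then show ?thesis
        using A A' im by metis
    qed
    moreover have "\<exists>B\<subseteq>att K. up K'' (down K'' D) = up K'' (down K'' (snd ?g ` B))" if D: "D \<subseteq> att K''" for D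
    proof -
      obtain B' where B': "B' \<subseteq> att K'" "up K'' (down K'' D) = up K'' (down K'' (\<beta>' ` B'))"
        using \<open>dense_pair K' K'' f'\<close> D unfolding dense_pair_def intent_dense_def f by auto
      obtain B where B: "B \<subseteq> att K" "up K' (down K' B') = up K' (down K' (\<beta> ` B))"
        using \<open>dense_pair K K' f\<close> B' unfolding dense_pair_def intent_dense_def f by auto
      have "down K'' (\<beta>' ` \<beta> ` B) = down K'' (\<beta>' ` B')"
        using B B'(1) mapping_pairsD(2)[OF m(1) B(1)] separately_continuous_down[OF m(2) s(2)] by metis
      then show ?thesis
        using B B' im by metis
    qed
    ultimately show ?thesis
      unfolding dense_pair_def extent_dense_def intent_dense_def split_beta by blast
  qed
  have c: "conceptual K K'' ?g" if c: "conceptual K K' f" "conceptual K' K'' f'"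
    unfolding conceptual_def split_beta prod.collapse
  proof (intro conjI ballI sc)
    fix x assume x: "x \<in> concepts K"
    obtain A B where AB: "x = (A, B)"
      by fastforce
    note k = conceptD[OF x[unfolded AB]]
    have "(down K' (\<beta> ` B), up K' (\<alpha> ` A)) \<in> concepts K'"
      using c(1) x by (auto simp: conceptual_def f AB)
    moreover from conceptD[OF this]
    have "up K' (down K' (\<beta> ` B)) = up K' (\<alpha> ` A)" "down K' (up K' (\<alpha> ` A)) = down K' (\<beta> ` B)"
      by simp_all
    \<comment> \<open>The middle pair is a concept, so each component is the polar of the other. The
      outer pair ignores the closures that arise, and its conceptuality applies to that
      concept.\<close>
    then have "down K'' (\<beta>' ` \<beta> ` B) = down K'' (\<beta>' ` up K' (\<alpha> ` A))"
      "up K'' (\<alpha>' ` \<alpha> ` A) = up K'' (\<alpha>' ` down K' (\<beta> ` B))"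
      using mapping_pairsD[OF m(1)] k separately_continuous_up[OF m(2) s(2)]
        separately_continuous_down[OF m(2) s(2)] by metis+
    ultimately show "(down K'' (snd ?g ` snd x), up K'' (fst ?g ` fst x)) \<in> concepts K''"
      using c(2) im k by (auto simp: conceptual_def f AB)
  qed
  show ?thesis
    using assms g sc cc e d c by (cases X) auto
qed

section \<open>Complete contexts\<close>

lemma complete_cxt_simps [simp]:
  "obj (complete_cxt L) = carrier L" "att (complete_cxt L) = carrier L"
  "(x, y) \<in> inc (complete_cxt L) \<longleftrightarrow> x \<in> carrier L \<and> y \<in> carrier L \<and> x \<sqsubseteq>\<^bsub>L\<^esub> y"
  by (simp_all add: complete_cxt_def)

lemma mapping_pairs_complete_cxt:
  "mapping_pairs (complete_cxt L) (complete_cxt L') =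
    (carrier L \<rightarrow>\<^sub>E carrier L') \<times> (carrier L \<rightarrow>\<^sub>E carrier L')"
  by (simp add: mapping_pairs_def)

text \<open>The Dedekind-MacNeille cut at \<open>x\<close>. Over a complete lattice it is both the
  object concept and the attribute concept of \<open>x\<close>, and every concept has this
  form.\<close>

definition principal_cut :: "'a gorder \<Rightarrow> 'a \<Rightarrow> 'a set \<times> 'a set"
  where "principal_cut L x = ({z \<in> carrier L. z \<sqsubseteq>\<^bsub>L\<^esub> x}, {z \<in> carrier L. x \<sqsubseteq>\<^bsub>L\<^esub> z})"

lemma complete_lattice_imp_partial_order: "complete_lattice L \<Longrightarrow> partial_order L"
  by (simp add: complete_lattice_def)

text \<open>Serves to derive the criterion for preserved meets from the one for preserved
  joins.\<close>

lemma complete_lattice_dual: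
  assumes "complete_lattice L"
  shows "complete_lattice (inv_gorder L)"
proof -
  interpret complete_lattice L
    by fact
  show ?thesis
    by (intro complete_lattice.intro dual_order complete_lattice_axioms.intro)
      (simp_all add: sup_exists inf_exists)
qed

section \<open>Bounds of joins and meets, and equality by comparison with test elements\<close>

context complete_lattice
begin

lemma sup_le_iff:
  assumes "A \<subseteq> carrier L" "z \<in> carrier L"
  shows "\<Squnion>A \<sqsubseteq> z \<longleftrightarrow> (\<forall>a\<in>A. a \<sqsubseteq> z)"
  using assms by (meson in_mono le_trans sup_closed sup_least sup_upper)

lemma le_inf_iff:
  assumes "A \<subseteq> carrier L" "z \<in> carrier L"
  shows "z \<sqsubseteq> \<Sqinter>A \<longleftrightarrow> (\<forall>a\<in>A. z \<sqsubseteq> a)"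
  using assms by (meson in_mono le_trans inf_closed inf_greatest inf_lower)

lemma eq_iff_le_iff:
  assumes "x \<in> carrier L" "y \<in> carrier L"
  shows "x = y \<longleftrightarrow> (\<forall>z\<in>carrier L. x \<sqsubseteq> z \<longleftrightarrow> y \<sqsubseteq> z)"
    "x = y \<longleftrightarrow> (\<forall>z\<in>carrier L. z \<sqsubseteq> x \<longleftrightarrow> z \<sqsubseteq> y)"
  using assms le_antisym le_refl by blast+

end

text \<open>\<open>complete_lattice\<close> is polymorphic in the record extension, whereas
  \<open>complete_cxt\<close> and \<open>principal_cut\<close> take a plain \<open>gorder\<close>;
  the locale fixes that type.\<close>

locale complete_gorder = complete_lattice L
  for L :: "'a gorder" (structure)
begin

lemma principal_cut_inject:
  assumes "x \<in> carrier L" "y \<in> carrier L"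
  shows "fst (principal_cut L x) = fst (principal_cut L y) \<longleftrightarrow> x = y"
    "snd (principal_cut L x) = snd (principal_cut L y) \<longleftrightarrow> x = y"
    "principal_cut L x = principal_cut L y \<longleftrightarrow> x = y"
  using assms eq_iff_le_iff[OF assms] by (auto simp: principal_cut_def)

text \<open>A set and its join have the same upper bounds, so the polars see only the join.\<close>

lemma down_up_complete_cxt:
  assumes "A \<subseteq> carrier L"
  shows "up (complete_cxt L) A = snd (principal_cut L (\<Squnion>A))"
    "down (complete_cxt L) (up (complete_cxt L) A) = fst (principal_cut L (\<Squnion>A))"
proof -
  show up: "up (complete_cxt L) A = snd (principal_cut L (\<Squnion>A))"
    using assms by (auto simp: up_def principal_cut_def sup_le_iff)
  show "down (complete_cxt L) (up (complete_cxt L) A) = fst (principal_cut L (\<Squnion>A))"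
    unfolding up using assms by (auto simp: down_def principal_cut_def intro: le_trans)
qed

lemma up_down_complete_cxt:
  assumes "B \<subseteq> carrier L"
  shows "down (complete_cxt L) B = fst (principal_cut L (\<Sqinter>B))"
    "up (complete_cxt L) (down (complete_cxt L) B) = snd (principal_cut L (\<Sqinter>B))"
proof -
  show down: "down (complete_cxt L) B = fst (principal_cut L (\<Sqinter>B))"
    using assms by (auto simp: down_def principal_cut_def le_inf_iff)
  show "up (complete_cxt L) (down (complete_cxt L) B) = snd (principal_cut L (\<Sqinter>B))"
    unfolding down using assms by (auto simp: up_def principal_cut_def intro: le_trans)
qed

lemma gam_complete_cxt: "x \<in> carrier L \<Longrightarrow> gam (complete_cxt L) x = principal_cut L x"
  and mu_complete_cxt: "x \<in> carrier L \<Longrightarrow> mu (complete_cxt L) x = principal_cut L x"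
  using down_up_complete_cxt[of "{x}"] up_down_complete_cxt[of "{x}"]
  by (simp_all add: gam_def mu_def)

lemma concepts_complete_cxt: "concepts (complete_cxt L) = principal_cut L ` carrier L"
proof (intro equalityI subsetI)
  fix c assume c: "c \<in> concepts (complete_cxt L)"
  obtain A B where AB: "c = (A, B)"
    by fastforce
  note d = conceptD[OF c[unfolded AB]]
  \<comment> \<open>The extent is closed, hence it is the ideal below its own join.\<close>
  have "c = principal_cut L (\<Squnion>A)"
    using d down_up_complete_cxt[of A] by (simp add: AB prod_eq_iff)
  then show "c \<in> principal_cut L ` carrier L"
    using d by simp
next
  fix c assume "c \<in> principal_cut L ` carrier L"
  then obtain x where x: "x \<in> carrier L" "c = gam (complete_cxt L) x"
    using gam_complete_cxt by auto
  then show "c \<in> concepts (complete_cxt L)"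
    by (simp add: gam_def)
qed

end

text \<open>The right-hand side says that preimages of principal ideals are principal, with
  \<open>z\<close> the value of an upper adjoint at \<open>y\<close>. Given preservation,
  \<open>z\<close> is the join of the preimage; conversely both sides of the join equation have the
  same upper bounds.\<close>

lemma sup_pres_iff:
  assumes "complete_lattice K" "complete_lattice L" and \<phi>: "\<phi> \<in> carrier K \<rightarrow> carrier L"
  shows "sup_pres K L \<phi> \<longleftrightarrow> (\<forall>y\<in>carrier L. \<exists>z\<in>carrier K. \<forall>x\<in>carrier K.
    \<phi> x \<sqsubseteq>\<^bsub>L\<^esub> y \<longleftrightarrow> x \<sqsubseteq>\<^bsub>K\<^esub> z)" (is "_ \<longleftrightarrow> ?R")
proof -
  interpret K: complete_lattice K by fact
  interpret L: complete_lattice L by fact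
  note mem = funcset_mem[OF \<phi>]
  show ?thesis
  proof
    assume s: "sup_pres K L \<phi>"
    then have iso: "isotone K L \<phi>"
      by (intro join_pres_isotone[OF \<phi>] sup_pres_is_join_pres weak_sup_pres)
    show ?R
    proof
      fix y assume y: "y \<in> carrier L"
      let ?S = "{x \<in> carrier K. \<phi> x \<sqsubseteq>\<^bsub>L\<^esub> y}"
      have S: "?S \<subseteq> carrier K" "\<phi> ` ?S \<subseteq> carrier L"
        using mem by auto
      have "\<phi> (\<Squnion>\<^bsub>K\<^esub>?S) = \<Squnion>\<^bsub>L\<^esub>(\<phi> ` ?S)"
        using s S by (simp add: sup_pres_def)
      then have le: "\<phi> (\<Squnion>\<^bsub>K\<^esub>?S) \<sqsubseteq>\<^bsub>L\<^esub> y"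
        using L.sup_le_iff[OF S(2) y] by simp
      have "\<phi> x \<sqsubseteq>\<^bsub>L\<^esub> y \<longleftrightarrow> x \<sqsubseteq>\<^bsub>K\<^esub> \<Squnion>\<^bsub>K\<^esub>?S" if x: "x \<in> carrier K" for x
      proof
        assume "\<phi> x \<sqsubseteq>\<^bsub>L\<^esub> y"
        then show "x \<sqsubseteq>\<^bsub>K\<^esub> \<Squnion>\<^bsub>K\<^esub>?S"
          using x by (intro K.sup_upper S) simp
      next
        assume "x \<sqsubseteq>\<^bsub>K\<^esub> \<Squnion>\<^bsub>K\<^esub>?S"
        then have "\<phi> x \<sqsubseteq>\<^bsub>L\<^esub> \<phi> (\<Squnion>\<^bsub>K\<^esub>?S)"
          using iso x S by (intro use_iso2[OF iso] K.sup_closed)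
        then show "\<phi> x \<sqsubseteq>\<^bsub>L\<^esub> y"
          using le x y S(1) mem by (intro L.le_trans[OF _ le]) simp_all
      qed
      then show "\<exists>z\<in>carrier K. \<forall>x\<in>carrier K. \<phi> x \<sqsubseteq>\<^bsub>L\<^esub> y \<longleftrightarrow> x \<sqsubseteq>\<^bsub>K\<^esub> z"
        using K.sup_closed[OF S(1)] by blast
    qed
  next
    assume R: ?R
    have "\<phi> (\<Squnion>\<^bsub>K\<^esub>S) = \<Squnion>\<^bsub>L\<^esub>(\<phi> ` S)" if S: "S \<subseteq> carrier K" for S
    proof -
      have S': "\<phi> ` S \<subseteq> carrier L"
        using S mem by auto
      have "\<phi> (\<Squnion>\<^bsub>K\<^esub>S) \<sqsubseteq>\<^bsub>L\<^esub> y \<longleftrightarrow> \<Squnion>\<^bsub>L\<^esub>(\<phi> ` S) \<sqsubseteq>\<^bsub>L\<^esub> y" if y: "y \<in> carrier L" for y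
      proof -
        obtain z where z: "z \<in> carrier K" "\<forall>x\<in>carrier K. \<phi> x \<sqsubseteq>\<^bsub>L\<^esub> y \<longleftrightarrow> x \<sqsubseteq>\<^bsub>K\<^esub> z"
          using bspec[OF R y] by (elim bexE)
        then have "\<phi> (\<Squnion>\<^bsub>K\<^esub>S) \<sqsubseteq>\<^bsub>L\<^esub> y \<longleftrightarrow> (\<forall>s\<in>S. s \<sqsubseteq>\<^bsub>K\<^esub> z)"
          using S by (simp add: K.sup_le_iff)
        also have "\<dots> \<longleftrightarrow> (\<forall>s\<in>S. \<phi> s \<sqsubseteq>\<^bsub>L\<^esub> y)"
          using z(2) S by (meson subsetD)
        also have "\<dots> \<longleftrightarrow> \<Squnion>\<^bsub>L\<^esub>(\<phi> ` S) \<sqsubseteq>\<^bsub>L\<^esub> y"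
          using S' y by (simp add: L.sup_le_iff)
        finally show ?thesis .
      qed
      then show ?thesis
        using S S' mem L.eq_iff_le_iff(1) by simp
    qed
    then show "sup_pres K L \<phi>"
      by (simp add: sup_pres_def assms)
  qed
qed

lemma inf_pres_iff:
  assumes "complete_lattice K" "complete_lattice L" "\<psi> \<in> carrier K \<rightarrow> carrier L"
  shows "inf_pres K L \<psi> \<longleftrightarrow> (\<forall>y\<in>carrier L. \<exists>z\<in>carrier K. \<forall>x\<in>carrier K.
    y \<sqsubseteq>\<^bsub>L\<^esub> \<psi> x \<longleftrightarrow> z \<sqsubseteq>\<^bsub>K\<^esub> x)"
proof -
  have "inf_pres K L \<psi> \<longleftrightarrow> sup_pres (inv_gorder K) (inv_gorder L) \<psi>"
    using assms by (simp add: inf_pres_def sup_pres_def complete_lattice_dual)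
  also have "\<dots> \<longleftrightarrow> (\<forall>y\<in>carrier L. \<exists>z\<in>carrier K. \<forall>x\<in>carrier K.
      y \<sqsubseteq>\<^bsub>L\<^esub> \<psi> x \<longleftrightarrow> z \<sqsubseteq>\<^bsub>K\<^esub> x)"
    using sup_pres_iff[of "inv_gorder K" "inv_gorder L" \<psi>] assms
    by (simp add: complete_lattice_dual)
  finally show ?thesis .
qed

lemma sup_pres_isotone: "\<phi> \<in> carrier K \<rightarrow> carrier L \<Longrightarrow> sup_pres K L \<phi> \<Longrightarrow> isotone K L \<phi>"
  by (intro join_pres_isotone sup_pres_is_join_pres weak_sup_pres)

lemma inf_pres_isotone: "\<psi> \<in> carrier K \<rightarrow> carrier L \<Longrightarrow> inf_pres K L \<psi> \<Longrightarrow> isotone K L \<psi>"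
  by (intro meet_pres_isotone inf_pres_is_meet_pres weak_inf_pres)

section \<open>Context morphisms between complete contexts\<close>

text \<open>No order condition is imposed on the two maps, so that each condition on mapping pairs
  can be translated into lattice terms separately.\<close>

locale complete_cxt_pair = K: complete_gorder K + L: complete_gorder L
  for K :: "'a gorder" and L :: "'b gorder" +
  fixes \<phi> \<psi> :: "'a \<Rightarrow> 'b"
  assumes phi: "\<phi> \<in> carrier K \<rightarrow>\<^sub>E carrier L" and psi: "\<psi> \<in> carrier K \<rightarrow>\<^sub>E carrier L"
begin

lemma phi_closed [simp]: "x \<in> carrier K \<Longrightarrow> \<phi> x \<in> carrier L"
  and psi_closed [simp]: "x \<in> carrier K \<Longrightarrow> \<psi> x \<in> carrier L"
  using phi psi by auto

lemma image_closed [simp]: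
  "A \<subseteq> carrier K \<Longrightarrow> \<phi> ` A \<subseteq> carrier L" "A \<subseteq> carrier K \<Longrightarrow> \<psi> ` A \<subseteq> carrier L"
  by auto

lemma lattices: "complete_lattice K" "complete_lattice L"
  by unfold_locales

lemma mapping_pair: "(\<phi>, \<psi>) \<in> mapping_pairs (complete_cxt K) (complete_cxt L)"
  using phi psi by (simp add: mapping_pairs_complete_cxt)

lemma sup_pres_phi_iff:
  "sup_pres K L \<phi> \<longleftrightarrow> (\<forall>y\<in>carrier L. \<exists>z\<in>carrier K. \<forall>x\<in>carrier K.
    \<phi> x \<sqsubseteq>\<^bsub>L\<^esub> y \<longleftrightarrow> x \<sqsubseteq>\<^bsub>K\<^esub> z)"
  using phi by (intro sup_pres_iff lattices) auto

lemma inf_pres_psi_iff: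
  "inf_pres K L \<psi> \<longleftrightarrow> (\<forall>y\<in>carrier L. \<exists>z\<in>carrier K. \<forall>x\<in>carrier K.
    y \<sqsubseteq>\<^bsub>L\<^esub> \<psi> x \<longleftrightarrow> z \<sqsubseteq>\<^bsub>K\<^esub> x)"
  using psi by (intro inf_pres_iff lattices) auto

lemma preimage_principal_cut:
  "{x \<in> carrier K. \<phi> x \<in> fst (principal_cut L y)} = {x \<in> carrier K. \<phi> x \<sqsubseteq>\<^bsub>L\<^esub> y}"
  "{x \<in> carrier K. \<psi> x \<in> snd (principal_cut L y)} = {x \<in> carrier K. y \<sqsubseteq>\<^bsub>L\<^esub> \<psi> x}"
  by (auto simp: principal_cut_def)

lemma Collect_eq_principal_cut_iff:
  "{x \<in> carrier K. P x} = fst (principal_cut K z) \<longleftrightarrow> (\<forall>x\<in>carrier K. P x \<longleftrightarrow> x \<sqsubseteq>\<^bsub>K\<^esub> z)"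
  "{x \<in> carrier K. P x} = snd (principal_cut K z) \<longleftrightarrow> (\<forall>x\<in>carrier K. P x \<longleftrightarrow> z \<sqsubseteq>\<^bsub>K\<^esub> x)"
  by (auto simp: principal_cut_def)

text \<open>Extents are principal ideals and intents are principal filters, so the two halves are
  the residuation criteria for joins and for meets.\<close>

lemma separately_continuous_iff:
  "separately_continuous (complete_cxt K) (complete_cxt L) (\<phi>, \<psi>) \<longleftrightarrow>
    sup_pres K L \<phi> \<and> inf_pres K L \<psi>"
proof -
  have ext: "{x \<in> carrier K. \<phi> x \<in> fst (principal_cut L y)} \<in> extents (complete_cxt K) \<longleftrightarrow>
      (\<exists>z\<in>carrier K. \<forall>x\<in>carrier K. \<phi> x \<sqsubseteq>\<^bsub>L\<^esub> y \<longleftrightarrow> x \<sqsubseteq>\<^bsub>K\<^esub> z)" for y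
    unfolding extents_eq K.concepts_complete_cxt preimage_principal_cut
    by (simp add: image_image image_iff Collect_eq_principal_cut_iff)
  have int: "{x \<in> carrier K. \<psi> x \<in> snd (principal_cut L y)} \<in> intents (complete_cxt K) \<longleftrightarrow>
      (\<exists>z\<in>carrier K. \<forall>x\<in>carrier K. y \<sqsubseteq>\<^bsub>L\<^esub> \<psi> x \<longleftrightarrow> z \<sqsubseteq>\<^bsub>K\<^esub> x)" for y
    unfolding intents_eq K.concepts_complete_cxt preimage_principal_cut
    by (simp add: image_image image_iff Collect_eq_principal_cut_iff)
  show ?thesis
    unfolding separately_continuous_def extents_eq[of "complete_cxt L"] intents_eq[of "complete_cxt L"]
      L.concepts_complete_cxt
    by (simp only: split_conv ball_simps complete_cxt_simps ext int sup_pres_phi_iff inf_pres_psi_iff)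
qed

text \<open>One \<open>z\<close> serves both equivalences, whereas separate continuity allows
  different ones for ideals and filters.\<close>

lemma concept_continuous_iff:
  "concept_continuous (complete_cxt K) (complete_cxt L) (\<phi>, \<psi>) \<longleftrightarrow>
    (\<forall>y\<in>carrier L. \<exists>z\<in>carrier K. \<forall>x\<in>carrier K.
      (\<phi> x \<sqsubseteq>\<^bsub>L\<^esub> y \<longleftrightarrow> x \<sqsubseteq>\<^bsub>K\<^esub> z) \<and> (y \<sqsubseteq>\<^bsub>L\<^esub> \<psi> x \<longleftrightarrow> z \<sqsubseteq>\<^bsub>K\<^esub> x))"
proof -
  have "({x \<in> carrier K. \<phi> x \<in> fst (principal_cut L y)}, {x \<in> carrier K. \<psi> x \<in> snd (principal_cut L y)})
      \<in> concepts (complete_cxt K) \<longleftrightarrow> (\<exists>z\<in>carrier K. \<forall>x\<in>carrier K.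
      (\<phi> x \<sqsubseteq>\<^bsub>L\<^esub> y \<longleftrightarrow> x \<sqsubseteq>\<^bsub>K\<^esub> z) \<and> (y \<sqsubseteq>\<^bsub>L\<^esub> \<psi> x \<longleftrightarrow> z \<sqsubseteq>\<^bsub>K\<^esub> x))" for y
    unfolding K.concepts_complete_cxt preimage_principal_cut
    by (simp add: image_iff prod_eq_iff Collect_eq_principal_cut_iff ball_conj_distrib)
  then show ?thesis
    unfolding concept_continuous_def L.concepts_complete_cxt
    by (simp only: split_beta fst_conv snd_conv ball_simps complete_cxt_simps)
qed

text \<open>By isotonicity the image of the ideal below \<open>x\<close> has the upper bounds of
  \<phi> x, and the image of the filter above \<open>x\<close> the lower bounds of \<psi> x. An
  ideal and a filter form a concept only if their generators agree.\<close>

lemma conceptual_iff: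
  "conceptual (complete_cxt K) (complete_cxt L) (\<phi>, \<psi>) \<longleftrightarrow>
    sup_pres K L \<phi> \<and> inf_pres K L \<psi> \<and> \<phi> = \<psi>"
proof (cases "sup_pres K L \<phi> \<and> inf_pres K L \<psi>")
  case True
  have iso: "isotone K L \<phi>" "isotone K L \<psi>"
    using True phi psi by (auto intro: sup_pres_isotone inf_pres_isotone)
  have down: "down (complete_cxt L) (\<psi> ` snd (principal_cut K x)) =
        {w \<in> carrier L. \<forall>z\<in>carrier K. x \<sqsubseteq>\<^bsub>K\<^esub> z \<longrightarrow> w \<sqsubseteq>\<^bsub>L\<^esub> \<psi> z}"
    and up: "up (complete_cxt L) (\<phi> ` fst (principal_cut K x)) =
        {w \<in> carrier L. \<forall>z\<in>carrier K. z \<sqsubseteq>\<^bsub>K\<^esub> x \<longrightarrow> \<phi> z \<sqsubseteq>\<^bsub>L\<^esub> w}" for x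
    by (auto simp: down_def up_def principal_cut_def)
  have *: "down (complete_cxt L) (\<psi> ` snd (principal_cut K x)) = fst (principal_cut L (\<psi> x))"
    "up (complete_cxt L) (\<phi> ` fst (principal_cut K x)) = snd (principal_cut L (\<phi> x))"
    if "x \<in> carrier K" for x
  proof -
    have "(\<forall>z\<in>carrier K. x \<sqsubseteq>\<^bsub>K\<^esub> z \<longrightarrow> w \<sqsubseteq>\<^bsub>L\<^esub> \<psi> z) \<longleftrightarrow> w \<sqsubseteq>\<^bsub>L\<^esub> \<psi> x" if "w \<in> carrier L" for w
      using \<open>x \<in> carrier K\<close> that iso by (meson K.le_refl L.le_trans psi_closed use_iso2)
    then show "down (complete_cxt L) (\<psi> ` snd (principal_cut K x)) = fst (principal_cut L (\<psi> x))"
      unfolding down by (auto simp: principal_cut_def)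
    have "(\<forall>z\<in>carrier K. z \<sqsubseteq>\<^bsub>K\<^esub> x \<longrightarrow> \<phi> z \<sqsubseteq>\<^bsub>L\<^esub> w) \<longleftrightarrow> \<phi> x \<sqsubseteq>\<^bsub>L\<^esub> w" if "w \<in> carrier L" for w
      using \<open>x \<in> carrier K\<close> that iso by (meson K.le_refl L.le_trans phi_closed use_iso2)
    then show "up (complete_cxt L) (\<phi> ` fst (principal_cut K x)) = snd (principal_cut L (\<phi> x))"
      unfolding up by (auto simp: principal_cut_def)
  qed
  have "(fst (principal_cut L (\<psi> x)), snd (principal_cut L (\<phi> x))) \<in> concepts (complete_cxt L)
      \<longleftrightarrow> \<phi> x = \<psi> x" if "x \<in> carrier K" for x
    using that L.principal_cut_inject(1,2)
    unfolding L.concepts_complete_cxt by (auto simp: image_iff prod_eq_iff)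
  then have "conceptual (complete_cxt K) (complete_cxt L) (\<phi>, \<psi>) \<longleftrightarrow> (\<forall>x\<in>carrier K. \<phi> x = \<psi> x)"
    using True unfolding conceptual_def split_conv split_beta separately_continuous_iff
      K.concepts_complete_cxt by (simp add: * separately_continuous_iff)
  also have "\<dots> \<longleftrightarrow> \<phi> = \<psi>"
    using PiE_ext[OF phi psi] by auto
  finally show ?thesis
    using True by simp
qed (auto simp: conceptual_def separately_continuous_iff)

text \<open>As \<phi> preserves joins, the closure of an image is the ideal below a value of \<phi>.
  Density thus asks every join to be a value; singletons on either side pass between this and
  surjectivity. The second component is dual.\<close>

lemma dense_pair_iff:
  assumes "sup_pres K L \<phi>" "inf_pres K L \<psi>"
  shows "dense_pair (complete_cxt K) (complete_cxt L) (\<phi>, \<psi>) \<longleftrightarrow>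
    \<phi> ` carrier K = carrier L \<and> \<psi> ` carrier K = carrier L"
proof -
  have phi_sup: "\<phi> (\<Squnion>\<^bsub>K\<^esub>A) = \<Squnion>\<^bsub>L\<^esub>(\<phi> ` A)" and psi_inf: "\<psi> (\<Sqinter>\<^bsub>K\<^esub>A) = \<Sqinter>\<^bsub>L\<^esub>(\<psi> ` A)"
    if "A \<subseteq> carrier K" for A
    using assms that by (simp_all add: sup_pres_def inf_pres_def)
  have "extent_dense (complete_cxt K) (complete_cxt L) \<phi> \<longleftrightarrow>
      (\<forall>C\<subseteq>carrier L. \<exists>A\<subseteq>carrier K. \<Squnion>\<^bsub>L\<^esub>C = \<phi> (\<Squnion>\<^bsub>K\<^esub>A))"
    unfolding extent_dense_def complete_cxt_simps
    by (intro all_cong1 imp_cong refl ex_cong1 conj_cong)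
      (simp add: L.down_up_complete_cxt(2) L.principal_cut_inject phi_sup)
  also have "\<dots> \<longleftrightarrow> \<phi> ` carrier K = carrier L"
  proof
    assume *: "\<forall>C\<subseteq>carrier L. \<exists>A\<subseteq>carrier K. \<Squnion>\<^bsub>L\<^esub>C = \<phi> (\<Squnion>\<^bsub>K\<^esub>A)"
    have "y \<in> \<phi> ` carrier K" if y: "y \<in> carrier L" for y
    proof -
      obtain A where "A \<subseteq> carrier K" "y = \<phi> (\<Squnion>\<^bsub>K\<^esub>A)"
        using *[rule_format, of "{y}"] y by auto
      then show ?thesis
        by auto
    qed
    then show "\<phi> ` carrier K = carrier L"
      by auto
  next
    assume *: "\<phi> ` carrier K = carrier L"
    show "\<forall>C\<subseteq>carrier L. \<exists>A\<subseteq>carrier K. \<Squnion>\<^bsub>L\<^esub>C = \<phi> (\<Squnion>\<^bsub>K\<^esub>A)"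
    proof (intro allI impI)
      fix C assume "C \<subseteq> carrier L"
      then have "\<Squnion>\<^bsub>L\<^esub>C \<in> \<phi> ` carrier K"
        by (simp add: *)
      then obtain x where "x \<in> carrier K" "\<Squnion>\<^bsub>L\<^esub>C = \<phi> x"
        by (elim imageE)
      then show "\<exists>A\<subseteq>carrier K. \<Squnion>\<^bsub>L\<^esub>C = \<phi> (\<Squnion>\<^bsub>K\<^esub>A)"
        by (intro exI[of _ "{x}"]) simp
    qed
  qed
  finally have e: "extent_dense (complete_cxt K) (complete_cxt L) \<phi> \<longleftrightarrow> \<phi> ` carrier K = carrier L" .
  have "intent_dense (complete_cxt K) (complete_cxt L) \<psi> \<longleftrightarrow>
      (\<forall>C\<subseteq>carrier L. \<exists>A\<subseteq>carrier K. \<Sqinter>\<^bsub>L\<^esub>C = \<psi> (\<Sqinter>\<^bsub>K\<^esub>A))"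
    unfolding intent_dense_def complete_cxt_simps
    by (intro all_cong1 imp_cong refl ex_cong1 conj_cong)
      (simp add: L.up_down_complete_cxt(2) L.principal_cut_inject psi_inf)
  also have "\<dots> \<longleftrightarrow> \<psi> ` carrier K = carrier L"
  proof
    assume *: "\<forall>C\<subseteq>carrier L. \<exists>A\<subseteq>carrier K. \<Sqinter>\<^bsub>L\<^esub>C = \<psi> (\<Sqinter>\<^bsub>K\<^esub>A)"
    have "y \<in> \<psi> ` carrier K" if y: "y \<in> carrier L" for y
    proof -
      obtain A where "A \<subseteq> carrier K" "y = \<psi> (\<Sqinter>\<^bsub>K\<^esub>A)"
        using *[rule_format, of "{y}"] y by auto
      then show ?thesis
        by auto
    qed
    then show "\<psi> ` carrier K = carrier L"
      by auto
  next
    assume *: "\<psi> ` carrier K = carrier L"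
    show "\<forall>C\<subseteq>carrier L. \<exists>A\<subseteq>carrier K. \<Sqinter>\<^bsub>L\<^esub>C = \<psi> (\<Sqinter>\<^bsub>K\<^esub>A)"
    proof (intro allI impI)
      fix C assume "C \<subseteq> carrier L"
      then have "\<Sqinter>\<^bsub>L\<^esub>C \<in> \<psi> ` carrier K"
        by (simp add: *)
      then obtain x where "x \<in> carrier K" "\<Sqinter>\<^bsub>L\<^esub>C = \<psi> x"
        by (elim imageE)
      then show "\<exists>A\<subseteq>carrier K. \<Sqinter>\<^bsub>L\<^esub>C = \<psi> (\<Sqinter>\<^bsub>K\<^esub>A)"
        by (intro exI[of _ "{x}"]) simp
    qed
  qed
  finally show ?thesis
    using e by (simp add: dense_pair_def)
qed

lemma cxt_embedding_iff:
  "cxt_embedding (complete_cxt K) (complete_cxt L) (\<phi>, \<psi>) \<longleftrightarrow>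
    (\<forall>x\<in>carrier K. \<forall>y\<in>carrier K. \<phi> x \<sqsubseteq>\<^bsub>L\<^esub> \<psi> y \<longleftrightarrow> x \<sqsubseteq>\<^bsub>K\<^esub> y)"
  by (auto simp: cxt_embedding_def)

end

section \<open>Doubly residuated and doubly residual maps\<close>

lemma galois_connection_iff:
  "galois_connection \<lparr>orderA = K, orderB = L, lower = \<phi>, upper = \<chi>\<rparr> \<longleftrightarrow>
    partial_order K \<and> partial_order L \<and> \<phi> \<in> carrier K \<rightarrow> carrier L \<and> \<chi> \<in> carrier L \<rightarrow> carrier K \<and>
    (\<forall>x\<in>carrier K. \<forall>y\<in>carrier L. \<phi> x \<sqsubseteq>\<^bsub>L\<^esub> y \<longleftrightarrow> x \<sqsubseteq>\<^bsub>K\<^esub> \<chi> y)"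
  by (auto simp: galois_connection_def connection_def galois_connection_axioms_def)

text \<open>A Galois connection says nothing outside the carriers, so the adjoint is unique only
  among extensional maps; hence the restriction.\<close>

lemma upper_adj_eq:
  assumes "galois_connection \<lparr>orderA = K, orderB = L, lower = \<phi>, upper = \<chi>\<rparr>"
  shows "upper_adj K L \<phi> = restrict \<chi> (carrier L)"
  unfolding upper_adj_def
proof (rule the_equality)
  note g = assms[unfolded galois_connection_iff]
  then interpret K: partial_order K by simp
  show "restrict \<chi> (carrier L) \<in> carrier L \<rightarrow>\<^sub>E carrier K \<and>
      galois_connection \<lparr>orderA = K, orderB = L, lower = \<phi>, upper = restrict \<chi> (carrier L)\<rparr>"
    using g by (simp add: galois_connection_iff restrict_Pi_cancel)
  fix \<chi>' assume \<chi>': "\<chi>' \<in> carrier L \<rightarrow>\<^sub>E carrier K \<and>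
    galois_connection \<lparr>orderA = K, orderB = L, lower = \<phi>, upper = \<chi>'\<rparr>"
  then have g': "\<forall>x\<in>carrier K. \<forall>y\<in>carrier L. x \<sqsubseteq>\<^bsub>K\<^esub> \<chi>' y \<longleftrightarrow> x \<sqsubseteq>\<^bsub>K\<^esub> \<chi> y"
    using g by (simp add: galois_connection_iff)
  have "\<chi>' y = \<chi> y" if y: "y \<in> carrier L" for y
  proof (rule K.le_antisym)
    show mem: "\<chi>' y \<in> carrier K" "\<chi> y \<in> carrier K"
      using \<chi>' g y by auto
    show "\<chi>' y \<sqsubseteq>\<^bsub>K\<^esub> \<chi> y" "\<chi> y \<sqsubseteq>\<^bsub>K\<^esub> \<chi>' y"
      using g' mem y by auto
  qed
  then show "\<chi>' = restrict \<chi> (carrier L)"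
    using \<chi>' by (intro PiE_ext[of \<chi>' "carrier L" "\<lambda>_. carrier K"]) (use g in auto)
qed

text \<open>A lower adjoint is an upper adjoint between the dual orders.\<close>

lemma lower_adj_eq:
  assumes "galois_connection \<lparr>orderA = K, orderB = L, lower = \<phi>, upper = \<chi>\<rparr>"
  shows "lower_adj L K \<chi> = restrict \<phi> (carrier K)"
  using upper_adj_eq[of "inv_gorder L" "inv_gorder K" \<chi> \<phi>] assms
  by (simp add: upper_adj_def lower_adj_def)

text \<open>The adjoint string of \<phi>, \<chi> and \<psi>, from left to right. It treats doubly
  residuated and doubly residual maps symmetrically: both kinds become the outer pairs of such
  strings.\<close>

definition adjoint_triple ::
    "'a gorder \<Rightarrow> 'b gorder \<Rightarrow> ('a \<Rightarrow> 'b) \<Rightarrow> ('b \<Rightarrow> 'a) \<Rightarrow> ('a \<Rightarrow> 'b) \<Rightarrow> bool"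
  where "adjoint_triple K L \<phi> \<chi> \<psi> \<longleftrightarrow>
    \<phi> \<in> carrier K \<rightarrow>\<^sub>E carrier L \<and> \<chi> \<in> carrier L \<rightarrow>\<^sub>E carrier K \<and> \<psi> \<in> carrier K \<rightarrow>\<^sub>E carrier L \<and>
    galois_connection \<lparr>orderA = K, orderB = L, lower = \<phi>, upper = \<chi>\<rparr> \<and>
    galois_connection \<lparr>orderA = L, orderB = K, lower = \<chi>, upper = \<psi>\<rparr>"

lemma adjoint_triple_adj:
  assumes "adjoint_triple K L \<phi> \<chi> \<psi>"
  shows "upper_adj K L \<phi> = \<chi>" "upper_adj L K \<chi> = \<psi>" "lower_adj K L \<psi> = \<chi>" "lower_adj L K \<chi> = \<phi>"
proof -
  have "restrict \<phi> (carrier K) = \<phi>" "restrict \<chi> (carrier L) = \<chi>" "restrict \<psi> (carrier K) = \<psi>"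
    using assms by (auto simp: adjoint_triple_def intro: PiE_restrict)
  then show "upper_adj K L \<phi> = \<chi>" "upper_adj L K \<chi> = \<psi>"
      "lower_adj K L \<psi> = \<chi>" "lower_adj L K \<chi> = \<phi>"
    using assms upper_adj_eq[of K L \<phi> \<chi>] upper_adj_eq[of L K \<chi> \<psi>]
      lower_adj_eq[of K L \<phi> \<chi>] lower_adj_eq[of L K \<chi> \<psi>]
    by (simp_all add: adjoint_triple_def)
qed

text \<open>\<open>P\<close> stands for surjectivity, injectivity or no condition, so one statement
  covers three categories. Here the condition falls on the first component, in
  \<open>pair_residual_image\<close> on the second.\<close>

lemma pair_residuated_image:
  "pair_residuated K L ` (doubly_residuated K L \<inter> P) = {(\<phi>, \<psi>). \<phi> \<in> P \<and> (\<exists>\<chi>. adjoint_triple K L \<phi> \<chi> \<psi>)}"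
proof (intro equalityI subsetI)
  fix h assume "h \<in> pair_residuated K L ` (doubly_residuated K L \<inter> P)"
  then obtain \<phi> where \<phi>: "\<phi> \<in> P" "\<phi> \<in> carrier K \<rightarrow>\<^sub>E carrier L" "lower_adjoint K L \<phi>"
      "lower_adjoint L K (upper_adj K L \<phi>)" and h: "h = pair_residuated K L \<phi>"
    by (auto simp: doubly_residuated_def)
  obtain \<chi> where \<chi>: "galois_connection \<lparr>orderA = K, orderB = L, lower = \<phi>, upper = \<chi>\<rparr>"
    using \<phi>(3) by (auto simp: lower_adjoint_def)
  obtain \<psi> where \<psi>: "galois_connection \<lparr>orderA = L, orderB = K, lower = upper_adj K L \<phi>, upper = \<psi>\<rparr>"
    using \<phi>(4) by (auto simp: lower_adjoint_def)
  have t: "adjoint_triple K L \<phi> (restrict \<chi> (carrier L)) (restrict \<psi> (carrier K))"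
    using \<phi>(2) \<chi> \<psi> upper_adj_eq[OF \<chi>] by (simp add: adjoint_triple_def galois_connection_iff restrict_Pi_cancel)
  then show "h \<in> {(\<phi>, \<psi>). \<phi> \<in> P \<and> (\<exists>\<chi>. adjoint_triple K L \<phi> \<chi> \<psi>)}"
    using \<phi>(1) h adjoint_triple_adj(1,2)[OF t] by (auto simp: pair_residuated_def)
next
  fix h assume "h \<in> {(\<phi>, \<psi>). \<phi> \<in> P \<and> (\<exists>\<chi>. adjoint_triple K L \<phi> \<chi> \<psi>)}"
  then obtain \<phi> \<chi> \<psi> where h: "h = (\<phi>, \<psi>)" "\<phi> \<in> P" and t: "adjoint_triple K L \<phi> \<chi> \<psi>"
    by auto
  note a = adjoint_triple_adj[OF t]
  have "h = pair_residuated K L \<phi>"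
    by (simp add: h a pair_residuated_def)
  moreover have "\<phi> \<in> doubly_residuated K L"
    using t by (auto simp: doubly_residuated_def a lower_adjoint_def adjoint_triple_def)
  ultimately show "h \<in> pair_residuated K L ` (doubly_residuated K L \<inter> P)"
    using h(2) by blast
qed

lemma pair_residual_image:
  "pair_residual K L ` (doubly_residual K L \<inter> P) = {(\<phi>, \<psi>). \<psi> \<in> P \<and> (\<exists>\<chi>. adjoint_triple K L \<phi> \<chi> \<psi>)}"
proof (intro equalityI subsetI)
  fix h assume "h \<in> pair_residual K L ` (doubly_residual K L \<inter> P)"
  then obtain \<psi> where \<psi>: "\<psi> \<in> P" "\<psi> \<in> carrier K \<rightarrow>\<^sub>E carrier L" "upper_adjoint L K \<psi>"
      "upper_adjoint K L (lower_adj K L \<psi>)" and h: "h = pair_residual K L \<psi>"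
    by (auto simp: doubly_residual_def)
  obtain \<chi> where \<chi>: "galois_connection \<lparr>orderA = L, orderB = K, lower = \<chi>, upper = \<psi>\<rparr>"
    using \<psi>(3) by (auto simp: upper_adjoint_def)
  obtain \<phi> where \<phi>: "galois_connection \<lparr>orderA = K, orderB = L, lower = \<phi>, upper = lower_adj K L \<psi>\<rparr>"
    using \<psi>(4) by (auto simp: upper_adjoint_def)
  have t: "adjoint_triple K L (restrict \<phi> (carrier K)) (restrict \<chi> (carrier L)) \<psi>"
    using \<psi>(2) \<chi> \<phi> lower_adj_eq[OF \<chi>] by (simp add: adjoint_triple_def galois_connection_iff restrict_Pi_cancel)
  then show "h \<in> {(\<phi>, \<psi>). \<psi> \<in> P \<and> (\<exists>\<chi>. adjoint_triple K L \<phi> \<chi> \<psi>)}"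
    using \<psi>(1) h adjoint_triple_adj(3,4)[OF t] by (auto simp: pair_residual_def)
next
  fix h assume "h \<in> {(\<phi>, \<psi>). \<psi> \<in> P \<and> (\<exists>\<chi>. adjoint_triple K L \<phi> \<chi> \<psi>)}"
  then obtain \<phi> \<chi> \<psi> where h: "h = (\<phi>, \<psi>)" "\<psi> \<in> P" and t: "adjoint_triple K L \<phi> \<chi> \<psi>"
    by auto
  note a = adjoint_triple_adj[OF t]
  have "h = pair_residual K L \<psi>"
    by (simp add: h a pair_residual_def)
  moreover have "\<psi> \<in> doubly_residual K L"
    using t by (auto simp: doubly_residual_def a upper_adjoint_def adjoint_triple_def)
  ultimately show "h \<in> pair_residual K L ` (doubly_residual K L \<inter> P)"
    using h(2) by blast
qed

text \<open>Both sides are equivalent to injectivity of the middle map: by the absorption laws,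
  either one makes the composite after \<chi> the identity.\<close>

lemma adjoint_triple_surj_iff:
  assumes "adjoint_triple K L \<phi> \<chi> \<psi>"
  shows "\<phi> ` carrier K = carrier L \<longleftrightarrow> \<psi> ` carrier K = carrier L"
proof -
  interpret g: galois_connection "\<lparr>orderA = K, orderB = L, lower = \<phi>, upper = \<chi>\<rparr>"
    using assms by (simp add: adjoint_triple_def)
  interpret h: galois_connection "\<lparr>orderA = L, orderB = K, lower = \<chi>, upper = \<psi>\<rparr>"
    using assms by (simp add: adjoint_triple_def)
  have m: "\<And>x. x \<in> carrier K \<Longrightarrow> \<phi> x \<in> carrier L" "\<And>y. y \<in> carrier L \<Longrightarrow> \<chi> y \<in> carrier K"
    "\<And>x. x \<in> carrier K \<Longrightarrow> \<psi> x \<in> carrier L"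
    using assms by (auto simp: adjoint_triple_def)
  have 1: "\<phi> ` carrier K = carrier L \<longleftrightarrow> inj_on \<chi> (carrier L)"
  proof
    assume "\<phi> ` carrier K = carrier L"
    then have "\<phi> (\<chi> y) = y" if "y \<in> carrier L" for y
      using that g.lower_comp by force
    then show "inj_on \<chi> (carrier L)"
      by (rule inj_on_inverseI)
  next
    assume "inj_on \<chi> (carrier L)"
    then have "\<phi> (\<chi> y) = y" if "y \<in> carrier L" for y
      using that g.upper_comp[of y] m by (auto dest: inj_onD)
    then show "\<phi> ` carrier K = carrier L"
      using m by (metis (no_types, lifting) image_eqI image_subsetI subsetI subset_antisym)
  qed
  have 2: "\<psi> ` carrier K = carrier L \<longleftrightarrow> inj_on \<chi> (carrier L)"
  proof
    assume "\<psi> ` carrier K = carrier L"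
    then have "\<psi> (\<chi> y) = y" if "y \<in> carrier L" for y
      using that h.upper_comp by force
    then show "inj_on \<chi> (carrier L)"
      by (rule inj_on_inverseI)
  next
    assume "inj_on \<chi> (carrier L)"
    then have "\<psi> (\<chi> y) = y" if "y \<in> carrier L" for y
      using that h.lower_comp[of y] m by (auto dest: inj_onD)
    then show "\<psi> ` carrier K = carrier L"
      using m by (metis (no_types, lifting) image_eqI image_subsetI subsetI subset_antisym)
  qed
  show ?thesis
    using 1 2 by simp
qed

text \<open>By adjointness, \<phi> x \<le> \<psi> y means \<chi> (\<phi> x) \<le> y, and also x
  \<le> \<chi> (\<psi> y). Injectivity of an outer map makes \<chi> its left inverse. Conversely,
  the embedding condition recovers all upper bounds of \<open>x\<close> from \<phi> x and all lower
  bounds from \<psi> x.\<close>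

lemma adjoint_triple_embedding_iff:
  assumes "adjoint_triple K L \<phi> \<chi> \<psi>"
  shows "(\<forall>x\<in>carrier K. \<forall>y\<in>carrier K. \<phi> x \<sqsubseteq>\<^bsub>L\<^esub> \<psi> y \<longleftrightarrow> x \<sqsubseteq>\<^bsub>K\<^esub> y) \<longleftrightarrow> inj_on \<phi> (carrier K)"
    and "(\<forall>x\<in>carrier K. \<forall>y\<in>carrier K. \<phi> x \<sqsubseteq>\<^bsub>L\<^esub> \<psi> y \<longleftrightarrow> x \<sqsubseteq>\<^bsub>K\<^esub> y) \<longleftrightarrow> inj_on \<psi> (carrier K)"
proof -
  interpret g: galois_connection "\<lparr>orderA = K, orderB = L, lower = \<phi>, upper = \<chi>\<rparr>"
    using assms by (simp add: adjoint_triple_def)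
  interpret h: galois_connection "\<lparr>orderA = L, orderB = K, lower = \<chi>, upper = \<psi>\<rparr>"
    using assms by (simp add: adjoint_triple_def)
  interpret K: partial_order K
    using g.is_order_A by simp
  have m: "\<And>x. x \<in> carrier K \<Longrightarrow> \<phi> x \<in> carrier L" "\<And>y. y \<in> carrier L \<Longrightarrow> \<chi> y \<in> carrier K"
    "\<And>x. x \<in> carrier K \<Longrightarrow> \<psi> x \<in> carrier L"
    using assms by (auto simp: adjoint_triple_def)
  let ?E = "\<forall>x\<in>carrier K. \<forall>y\<in>carrier K. \<phi> x \<sqsubseteq>\<^bsub>L\<^esub> \<psi> y \<longleftrightarrow> x \<sqsubseteq>\<^bsub>K\<^esub> y"
  show "?E \<longleftrightarrow> inj_on \<phi> (carrier K)"
  proof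
    assume E: ?E
    show "inj_on \<phi> (carrier K)"
    proof (rule inj_onI)
      fix x y assume xy: "x \<in> carrier K" "y \<in> carrier K" "\<phi> x = \<phi> y"
      have "x \<sqsubseteq>\<^bsub>K\<^esub> z \<longleftrightarrow> y \<sqsubseteq>\<^bsub>K\<^esub> z" if "z \<in> carrier K" for z
        using E xy that by metis
      then show "x = y"
        using xy by (intro K.le_antisym) auto
    qed
  next
    assume "inj_on \<phi> (carrier K)"
    then have inv: "\<chi> (\<phi> x) = x" if "x \<in> carrier K" for x
      using that g.lower_comp[of x] m by (auto dest: inj_onD)
    show ?E
    proof (intro ballI)
      fix x y assume "x \<in> carrier K" "y \<in> carrier K"
      then show "\<phi> x \<sqsubseteq>\<^bsub>L\<^esub> \<psi> y \<longleftrightarrow> x \<sqsubseteq>\<^bsub>K\<^esub> y"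
        using h.galois_property[of "\<phi> x" y] m inv by simp
    qed
  qed
  show "?E \<longleftrightarrow> inj_on \<psi> (carrier K)"
  proof
    assume E: ?E
    show "inj_on \<psi> (carrier K)"
    proof (rule inj_onI)
      fix x y assume xy: "x \<in> carrier K" "y \<in> carrier K" "\<psi> x = \<psi> y"
      have "z \<sqsubseteq>\<^bsub>K\<^esub> x \<longleftrightarrow> z \<sqsubseteq>\<^bsub>K\<^esub> y" if "z \<in> carrier K" for z
        using E xy that by metis
      then show "x = y"
        using xy by (intro K.le_antisym) auto
    qed
  next
    assume "inj_on \<psi> (carrier K)"
    then have inv: "\<chi> (\<psi> x) = x" if "x \<in> carrier K" for x
      using that h.upper_comp[of x] m by (auto dest: inj_onD)
    show ?E
    proof (intro ballI)
      fix x y assume "x \<in> carrier K" "y \<in> carrier K"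
      then show "\<phi> x \<sqsubseteq>\<^bsub>L\<^esub> \<psi> y \<longleftrightarrow> x \<sqsubseteq>\<^bsub>K\<^esub> y"
        using g.galois_property[of x "\<psi> y"] m inv by simp
    qed
  qed
qed

section \<open>Concept continuity as adjointness; isomorphisms and embeddings\<close>

context complete_cxt_pair
begin

text \<open>The middle map chooses for each \<open>y\<close> the common generator of
  \<open>concept_continuous_iff\<close>; the restriction makes it extensional.\<close>

lemma concept_continuous_iff_adjoint_triple:
  "concept_continuous (complete_cxt K) (complete_cxt L) (\<phi>, \<psi>) \<longleftrightarrow> (\<exists>\<chi>. adjoint_triple K L \<phi> \<chi> \<psi>)"
proof
  assume "concept_continuous (complete_cxt K) (complete_cxt L) (\<phi>, \<psi>)"
  then obtain \<chi> where \<chi>: "\<forall>y\<in>carrier L. \<chi> y \<in> carrier K \<and> (\<forall>x\<in>carrier K.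
      (\<phi> x \<sqsubseteq>\<^bsub>L\<^esub> y \<longleftrightarrow> x \<sqsubseteq>\<^bsub>K\<^esub> \<chi> y) \<and> (y \<sqsubseteq>\<^bsub>L\<^esub> \<psi> x \<longleftrightarrow> \<chi> y \<sqsubseteq>\<^bsub>K\<^esub> x))"
    unfolding concept_continuous_iff Bex_def by (elim bchoice[THEN exE])
  have "adjoint_triple K L \<phi> (restrict \<chi> (carrier L)) \<psi>"
    using \<chi> phi psi lattices[THEN complete_lattice_imp_partial_order]
    by (auto simp: adjoint_triple_def galois_connection_iff)
  then show "\<exists>\<chi>. adjoint_triple K L \<phi> \<chi> \<psi>"
    by blast
next
  assume "\<exists>\<chi>. adjoint_triple K L \<phi> \<chi> \<psi>"
  then obtain \<chi> where \<chi>: "adjoint_triple K L \<phi> \<chi> \<psi>" ..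
  then have *: "\<chi> y \<in> carrier K \<and> (\<forall>x\<in>carrier K.
      (\<phi> x \<sqsubseteq>\<^bsub>L\<^esub> y \<longleftrightarrow> x \<sqsubseteq>\<^bsub>K\<^esub> \<chi> y) \<and> (y \<sqsubseteq>\<^bsub>L\<^esub> \<psi> x \<longleftrightarrow> \<chi> y \<sqsubseteq>\<^bsub>K\<^esub> x))" if "y \<in> carrier L" for y
    using that by (auto simp: adjoint_triple_def galois_connection_iff)
  show "concept_continuous (complete_cxt K) (complete_cxt L) (\<phi>, \<psi>)"
    unfolding concept_continuous_iff
  proof
    fix y assume "y \<in> carrier L"
    from *[OF this] show "\<exists>z\<in>carrier K. \<forall>x\<in>carrier K.
      (\<phi> x \<sqsubseteq>\<^bsub>L\<^esub> y \<longleftrightarrow> x \<sqsubseteq>\<^bsub>K\<^esub> z) \<and> (y \<sqsubseteq>\<^bsub>L\<^esub> \<psi> x \<longleftrightarrow> z \<sqsubseteq>\<^bsub>K\<^esub> x)"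
      by (intro bexI[of _ "\<chi> y"]) simp_all
  qed
qed

text \<open>Places the counit in every hom-set at once. Every \<open>y\<close> is a value at some
  \<open>z\<close>, and this \<open>z\<close> generates both preimages.\<close>

lemma lattice_iso_imp_cxt_hom:
  assumes "\<phi> \<in> lattice_isos K L" "\<psi> = \<phi>"
  shows "(\<phi>, \<psi>) \<in> cxt_hom X (complete_cxt K) (complete_cxt L)"
proof -
  have bij: "\<phi> ` carrier K = carrier L" and
    emb: "\<And>x y. x \<in> carrier K \<Longrightarrow> y \<in> carrier K \<Longrightarrow> \<phi> x \<sqsubseteq>\<^bsub>L\<^esub> \<phi> y \<longleftrightarrow> x \<sqsubseteq>\<^bsub>K\<^esub> y"
    using assms(1) by (auto simp: lattice_isos_def bij_betw_def order_emb_def)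
  have e: "cxt_embedding (complete_cxt K) (complete_cxt L) (\<phi>, \<psi>)"
    unfolding cxt_embedding_iff using emb assms(2) by simp
  have cc: "concept_continuous (complete_cxt K) (complete_cxt L) (\<phi>, \<psi>)"
    unfolding concept_continuous_iff
  proof
    fix y assume "y \<in> carrier L"
    then obtain z where z: "z \<in> carrier K" "y = \<phi> z"
      using bij by auto
    then show "\<exists>z\<in>carrier K. \<forall>x\<in>carrier K.
      (\<phi> x \<sqsubseteq>\<^bsub>L\<^esub> y \<longleftrightarrow> x \<sqsubseteq>\<^bsub>K\<^esub> z) \<and> (y \<sqsubseteq>\<^bsub>L\<^esub> \<psi> x \<longleftrightarrow> z \<sqsubseteq>\<^bsub>K\<^esub> x)"
      by (intro bexI[OF _ z(1)] ballI) (simp add: z emb assms(2))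
  qed
  note s = concept_continuous_imp_separately_continuous[OF cc]
  have c: "conceptual (complete_cxt K) (complete_cxt L) (\<phi>, \<psi>)"
    using s assms(2) unfolding separately_continuous_iff conceptual_iff by simp
  have d: "dense_pair (complete_cxt K) (complete_cxt L) (\<phi>, \<psi>)"
    using s bij assms(2) unfolding separately_continuous_iff by (subst dense_pair_iff) simp_all
  show ?thesis
    using mapping_pair e cc s c d by (cases X) auto
qed


text \<open>An injective join-preserving map reflects the order: if \<phi> x \<le> \<phi> y, then
  the join of \<open>x\<close> and \<open>y\<close> has the value \<phi> y, so it equals
  \<open>y\<close>.\<close>

lemma embedding_iff_inj:
  assumes "sup_pres K L \<phi>" "\<psi> = \<phi>"
  shows "(\<forall>x\<in>carrier K. \<forall>y\<in>carrier K. \<phi> x \<sqsubseteq>\<^bsub>L\<^esub> \<psi> y \<longleftrightarrow> x \<sqsubseteq>\<^bsub>K\<^esub> y) \<longleftrightarrow> inj_on \<phi> (carrier K)"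
proof
  assume E: "\<forall>x\<in>carrier K. \<forall>y\<in>carrier K. \<phi> x \<sqsubseteq>\<^bsub>L\<^esub> \<psi> y \<longleftrightarrow> x \<sqsubseteq>\<^bsub>K\<^esub> y"
  show "inj_on \<phi> (carrier K)"
  proof (rule inj_onI)
    fix x y assume xy: "x \<in> carrier K" "y \<in> carrier K" "\<phi> x = \<phi> y"
    then have "\<phi> x \<sqsubseteq>\<^bsub>L\<^esub> \<psi> y" "\<phi> y \<sqsubseteq>\<^bsub>L\<^esub> \<psi> x"
      using assms(2) by auto
    then have "x \<sqsubseteq>\<^bsub>K\<^esub> y" "y \<sqsubseteq>\<^bsub>K\<^esub> x"
      using E xy by blast+
    then show "x = y"
      using xy by (intro K.le_antisym)
  qed
next
  assume inj: "inj_on \<phi> (carrier K)"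
  have iso: "isotone K L \<phi>"
    using assms(1) phi by (auto intro: sup_pres_isotone)
  show "\<forall>x\<in>carrier K. \<forall>y\<in>carrier K. \<phi> x \<sqsubseteq>\<^bsub>L\<^esub> \<psi> y \<longleftrightarrow> x \<sqsubseteq>\<^bsub>K\<^esub> y"
  proof (intro ballI iffI)
    fix x y assume xy: "x \<in> carrier K" "y \<in> carrier K"
    then have S: "{x, y} \<subseteq> carrier K" "{\<phi> x, \<phi> y} \<subseteq> carrier L"
      by auto
    show "\<phi> x \<sqsubseteq>\<^bsub>L\<^esub> \<psi> y" if "x \<sqsubseteq>\<^bsub>K\<^esub> y"
      using use_iso2[OF iso xy that] assms(2) by simp
    assume "\<phi> x \<sqsubseteq>\<^bsub>L\<^esub> \<psi> y"
    then have "\<Squnion>\<^bsub>L\<^esub>{\<phi> x, \<phi> y} = \<phi> y"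
      using S assms(2) by (intro L.le_antisym L.sup_least L.sup_upper) auto
    moreover have "\<phi> (\<Squnion>\<^bsub>K\<^esub>{x, y}) = \<Squnion>\<^bsub>L\<^esub>{\<phi> x, \<phi> y}"
      using assms(1) S(1) by (simp add: sup_pres_def)
    ultimately have "\<Squnion>\<^bsub>K\<^esub>{x, y} = y"
      using inj S(1) xy(2) by (intro inj_onD[OF inj]) simp_all
    then show "x \<sqsubseteq>\<^bsub>K\<^esub> y"
      using K.sup_upper[OF S(1), of x] by simp
  qed
qed

text \<open>That the components agree comes from surjectivity of \<psi>: if \<phi> x = \<psi> y, the
  embedding gives x \<le> y, so \<psi> x \<le> \<psi> y = \<phi> x. The converse inequality is the
  embedding at \<open>x\<close> and \<open>x\<close>.\<close>

lemma dense_embedding_imp_lattice_iso: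
  assumes "dense_pair (complete_cxt K) (complete_cxt L) (\<phi>, \<psi>)"
    and "cxt_embedding (complete_cxt K) (complete_cxt L) (\<phi>, \<psi>)"
  shows "\<phi> \<in> lattice_isos K L \<and> \<psi> = \<phi>"
proof -
  have "concept_continuous (complete_cxt K) (complete_cxt L) (\<phi>, \<psi>)"
    by (intro dense_embedding_imp_concept_continuous mapping_pair assms)
  then have sp: "sup_pres K L \<phi>" "inf_pres K L \<psi>"
    using concept_continuous_imp_separately_continuous separately_continuous_iff by auto
  then have surj: "\<phi> ` carrier K = carrier L" "\<psi> ` carrier K = carrier L"
    using assms(1) dense_pair_iff by auto
  have emb: "\<phi> x \<sqsubseteq>\<^bsub>L\<^esub> \<psi> y \<longleftrightarrow> x \<sqsubseteq>\<^bsub>K\<^esub> y" if "x \<in> carrier K" "y \<in> carrier K" for x y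
    using assms(2) that unfolding cxt_embedding_iff by simp
  have iso: "isotone K L \<psi>"
    using sp(2) psi by (auto intro: inf_pres_isotone)
  have "\<psi> x = \<phi> x" if x: "x \<in> carrier K" for x
  proof (rule L.le_antisym)
    have "\<phi> x \<in> \<psi> ` carrier K"
      using x surj(2) by simp
    then obtain y where y: "y \<in> carrier K" "\<phi> x = \<psi> y"
      by (elim imageE)
    then have "x \<sqsubseteq>\<^bsub>K\<^esub> y"
      using emb[of x y] x by simp
    then show "\<psi> x \<sqsubseteq>\<^bsub>L\<^esub> \<phi> x"
      using use_iso2[OF iso] x y by simp
    show "\<phi> x \<sqsubseteq>\<^bsub>L\<^esub> \<psi> x"
      using emb x by simp
  qed (use x in simp_all)
  then have eq: "\<psi> = \<phi>"
    by (intro PiE_ext[OF psi phi])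
  then have "inj_on \<phi> (carrier K)"
    using embedding_iff_inj[OF sp(1)] emb by simp
  then have "\<phi> \<in> lattice_isos K L"
    using phi surj(1) emb K.weak_partial_order_axioms L.weak_partial_order_axioms unfolding eq
    by (simp add: lattice_isos_def bij_betw_def order_emb_def)
  then show ?thesis
    using eq by simp
qed

end

section \<open>Lattice morphisms as context morphisms\<close>

definition paired_cats :: "(cxt_cat \<times> lat_cat) set"
  where "paired_cats = {(Cjm, CLjm), (Cc, CLc), (Ccd, CLcd), (Cce, CLce), (Cde, CLis),
    (Ccc, CLc_low), (Ccc, CLc_up), (Cccd, CLc_low_d), (Cccd, CLc_up_d),
    (Ccce, CLc_low_e), (Ccce, CLc_up_e)}"

lemma pair_hom_image_iff: "(\<phi>, \<psi>) \<in> pair_hom ` A \<longleftrightarrow> \<phi> \<in> A \<and> \<psi> = \<phi>"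
  by (auto simp: pair_hom_def)

text \<open>As sets of pairs, the residuated and the residual hom-sets differ only in the component
  that carries the surjectivity or injectivity condition.\<close>

lemma lat_hom_residuated_iff:
  "(\<phi>, \<psi>) \<in> lat_hom CLc_low K L \<longleftrightarrow> (\<exists>\<chi>. adjoint_triple K L \<phi> \<chi> \<psi>)"
  "(\<phi>, \<psi>) \<in> lat_hom CLc_low_d K L \<longleftrightarrow> \<phi> ` carrier K = carrier L \<and> (\<exists>\<chi>. adjoint_triple K L \<phi> \<chi> \<psi>)"
  "(\<phi>, \<psi>) \<in> lat_hom CLc_low_e K L \<longleftrightarrow> inj_on \<phi> (carrier K) \<and> (\<exists>\<chi>. adjoint_triple K L \<phi> \<chi> \<psi>)"
  "(\<phi>, \<psi>) \<in> lat_hom CLc_up K L \<longleftrightarrow> (\<exists>\<chi>. adjoint_triple K L \<phi> \<chi> \<psi>)"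
  "(\<phi>, \<psi>) \<in> lat_hom CLc_up_d K L \<longleftrightarrow> \<psi> ` carrier K = carrier L \<and> (\<exists>\<chi>. adjoint_triple K L \<phi> \<chi> \<psi>)"
  "(\<phi>, \<psi>) \<in> lat_hom CLc_up_e K L \<longleftrightarrow> inj_on \<psi> (carrier K) \<and> (\<exists>\<chi>. adjoint_triple K L \<phi> \<chi> \<psi>)"
  using pair_residuated_image[of K L UNIV] pair_residual_image[of K L UNIV]
  by (simp_all add: pair_residuated_image pair_residual_image surj_maps_def inj_maps_def)

lemma lat_hom_imp_PiE:
  assumes "(\<phi>, \<psi>) \<in> lat_hom Y K L"
  shows "\<phi> \<in> carrier K \<rightarrow>\<^sub>E carrier L" "\<psi> \<in> carrier K \<rightarrow>\<^sub>E carrier L"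
proof -
  have "adjoint_triple K L \<phi> \<chi> \<psi> \<Longrightarrow> \<phi> \<in> carrier K \<rightarrow>\<^sub>E carrier L \<and> \<psi> \<in> carrier K \<rightarrow>\<^sub>E carrier L" for \<chi>
    by (simp add: adjoint_triple_def)
  then have "\<phi> \<in> carrier K \<rightarrow>\<^sub>E carrier L \<and> \<psi> \<in> carrier K \<rightarrow>\<^sub>E carrier L"
    using assms by (cases Y; simp only: lat_hom_residuated_iff)
      (auto simp: pair_hom_image_iff complete_homs_def lattice_isos_def)
  then show "\<phi> \<in> carrier K \<rightarrow>\<^sub>E carrier L" "\<psi> \<in> carrier K \<rightarrow>\<^sub>E carrier L"
    by simp_all
qed

lemma (in complete_cxt_pair) mem_lat_hom_iff:
  assumes "(X, Y) \<in> paired_cats"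
  shows "(\<phi>, \<psi>) \<in> lat_hom Y K L \<longleftrightarrow> (\<phi>, \<psi>) \<in> cxt_hom X (complete_cxt K) (complete_cxt L)"
proof -
  let ?CK = "complete_cxt K" and ?CL = "complete_cxt L"
  let ?sp = "sup_pres K L \<phi> \<and> inf_pres K L \<psi>" and ?cc = "\<exists>\<chi>. adjoint_triple K L \<phi> \<chi> \<psi>"
  have cc_sp: ?sp if ?cc
    using that concept_continuous_iff_adjoint_triple concept_continuous_imp_separately_continuous
      separately_continuous_iff by blast
  have hom: "\<phi> \<in> complete_homs K L \<and> \<psi> = \<phi> \<longleftrightarrow> ?sp \<and> \<phi> = \<psi>"
    using phi by (auto simp: complete_homs_def)
  have isos: "\<phi> \<in> lattice_isos K L \<and> \<psi> = \<phi> \<longleftrightarrow>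
      dense_pair ?CK ?CL (\<phi>, \<psi>) \<and> cxt_embedding ?CK ?CL (\<phi>, \<psi>)"
    using lattice_iso_imp_cxt_hom[of Cde] dense_embedding_imp_lattice_iso by auto
  \<comment> \<open>An adjoint triple preserves joins and meets, so density means that both
    components are onto; for outer maps of a triple, one being onto is enough.\<close>
  have surj: "\<phi> ` carrier K = carrier L \<and> ?cc \<longleftrightarrow> dense_pair ?CK ?CL (\<phi>, \<psi>) \<and> ?cc"
    "\<psi> ` carrier K = carrier L \<and> ?cc \<longleftrightarrow> dense_pair ?CK ?CL (\<phi>, \<psi>) \<and> ?cc"
    using cc_sp dense_pair_iff adjoint_triple_surj_iff[of K L \<phi> _ \<psi>] by blast+
  have inj: "inj_on \<phi> (carrier K) \<and> ?cc \<longleftrightarrow> ?cc \<and> cxt_embedding ?CK ?CL (\<phi>, \<psi>)"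
    "inj_on \<psi> (carrier K) \<and> ?cc \<longleftrightarrow> ?cc \<and> cxt_embedding ?CK ?CL (\<phi>, \<psi>)"
    unfolding cxt_embedding_iff
    using adjoint_triple_embedding_iff(1)[of K L \<phi> _ \<psi>] adjoint_triple_embedding_iff(2)[of K L \<phi> _ \<psi>]
    by auto
  note cxt = cxt_hom.simps mem_Collect_eq mapping_pair simp_thms separately_continuous_iff conceptual_iff
    concept_continuous_iff_adjoint_triple
  \<comment> \<open>\<open>P\<close> is the condition added to complete homomorphisms, trivial for
    \<open>CLc\<close>.\<close>
  have pairs: "(\<phi>, \<psi>) \<in> lat_hom Cat K L \<longleftrightarrow> \<phi> \<in> complete_homs K L \<and> \<psi> = \<phi> \<and> P"
    if "(Cat, P) \<in> {(CLc, True), (CLcd, \<phi> ` carrier K = carrier L), (CLce, inj_on \<phi> (carrier K))}" for Cat P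
    using that by (auto simp: pair_hom_image_iff surj_maps_def inj_maps_def)
  consider (jm) "X = Cjm" "Y = CLjm" | (c) "X = Cc" "Y = CLc" | (cd) "X = Ccd" "Y = CLcd"
    | (ce) "X = Cce" "Y = CLce" | (iso) "X = Cde" "Y = CLis"
    | (low) "X = Ccc" "Y = CLc_low" | (up) "X = Ccc" "Y = CLc_up"
    | (lowd) "X = Cccd" "Y = CLc_low_d" | (upd) "X = Cccd" "Y = CLc_up_d"
    | (lowe) "X = Ccce" "Y = CLc_low_e" | (upe) "X = Ccce" "Y = CLc_up_e"
    using assms by (auto simp: paired_cats_def)
  then show ?thesis
  proof cases
    case jm
    then show ?thesis
      using phi psi by (simp only: cxt) auto
  next
    case c
    then show ?thesis
      using hom pairs[of CLc] by (simp only: cxt) auto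
  next
    case cd
    then show ?thesis
      using hom pairs[of CLcd "\<phi> ` carrier K = carrier L"] dense_pair_iff by (simp only: cxt) auto
  next
    case ce
    then show ?thesis
      using hom pairs[of CLce "inj_on \<phi> (carrier K)"] embedding_iff_inj
      by (simp only: cxt cxt_embedding_iff) blast
  next
    case iso
    then show ?thesis
      using isos by (simp only: cxt lat_hom.simps pair_hom_image_iff)
  next
    case low
    then show ?thesis
      by (simp only: cxt lat_hom_residuated_iff)
  next
    case up
    then show ?thesis
      by (simp only: cxt lat_hom_residuated_iff)
  next
    case lowd
    then show ?thesis
      using surj by (simp only: cxt lat_hom_residuated_iff)
  next
    case upd
    then show ?thesis
      using surj by (simp only: cxt lat_hom_residuated_iff)
  next
    case lowe
    then show ?thesis
      using inj by (simp only: cxt lat_hom_residuated_iff)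
  next
    case upe
    then show ?thesis
      using inj by (simp only: cxt lat_hom_residuated_iff)
  qed
qed

lemma lat_hom_eq_cxt_hom:
  assumes "(X, Y) \<in> paired_cats" "complete_lattice K" "complete_lattice L"
  shows "lat_hom Y K L = cxt_hom X (complete_cxt K) (complete_cxt L)"
proof -
  have "(\<phi>, \<psi>) \<in> lat_hom Y K L \<longleftrightarrow> (\<phi>, \<psi>) \<in> cxt_hom X (complete_cxt K) (complete_cxt L)" for \<phi> \<psi>
  proof (cases "\<phi> \<in> carrier K \<rightarrow>\<^sub>E carrier L \<and> \<psi> \<in> carrier K \<rightarrow>\<^sub>E carrier L")
    case True
    interpret complete_cxt_pair K L \<phi> \<psi>
      by (intro complete_cxt_pair.intro complete_gorder.intro complete_cxt_pair_axioms.intro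
          assms True[THEN conjunct1] True[THEN conjunct2])
    show ?thesis
      by (rule mem_lat_hom_iff) fact
  next
    case False
    \<comment> \<open>Both hom-sets contain only extensional maps between the carriers, so
      membership fails on both sides.\<close>
    then have "(\<phi>, \<psi>) \<notin> lat_hom Y K L"
      using lat_hom_imp_PiE by blast
    moreover have "(\<phi>, \<psi>) \<notin> cxt_hom X (complete_cxt K) (complete_cxt L)"
      using False cxt_hom_imp_Cjm[of "(\<phi>, \<psi>)" X "complete_cxt K" "complete_cxt L"]
      by (auto simp: mapping_pairs_complete_cxt)
    ultimately show ?thesis
      by simp
  qed
  then show ?thesis
    by auto
qed

section \<open>The functor from contexts to lattices\<close>

lemma Bmor_simps:
  assumes "x \<in> concepts K"
  shows "fst (Bmor K L (\<alpha>, \<beta>)) x = (down L (up L (\<alpha> ` fst x)), up L (\<alpha> ` fst x))"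
    "snd (Bmor K L (\<alpha>, \<beta>)) x = (down L (\<beta> ` snd x), up L (down L (\<beta> ` snd x)))"
  using assms by (simp_all add: Bmor_def split_beta)

lemma Bmor_in_PiE:
  assumes "(\<alpha>, \<beta>) \<in> mapping_pairs K L"
  shows "fst (Bmor K L (\<alpha>, \<beta>)) \<in> carrier (concept_lattice K) \<rightarrow>\<^sub>E carrier (concept_lattice L)"
    "snd (Bmor K L (\<alpha>, \<beta>)) \<in> carrier (concept_lattice K) \<rightarrow>\<^sub>E carrier (concept_lattice L)"
  using mapping_pairsD[OF assms]
  by (auto simp: Bmor_def split_beta dest: conceptD(1,2))

text \<open>Stated between complete contexts, so that each condition on \<open>f\<close> is carried
  to the same condition on the lifted pair.\<close>

lemma Bmor_in_cxt_hom:
  assumes f: "f \<in> cxt_hom X K L"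
  shows "Bmor K L f \<in> cxt_hom X (complete_cxt (concept_lattice K)) (complete_cxt (concept_lattice L))"
proof -
  obtain \<alpha> \<beta> where ab: "f = (\<alpha>, \<beta>)"
    by fastforce
  define \<phi> \<psi> where "\<phi> = fst (Bmor K L f)" and "\<psi> = snd (Bmor K L f)"
  note def = \<phi>_def \<psi>_def
  have B: "Bmor K L f = (\<phi>, \<psi>)"
    by (simp add: def)
  have m: "(\<alpha>, \<beta>) \<in> mapping_pairs K L" and s: "separately_continuous K L (\<alpha>, \<beta>)"
    using cxt_hom_imp_Cjm[OF f] by (auto simp: ab)
  note im = mapping_pairsD[OF m]
  interpret complete_cxt_pair "concept_lattice K" "concept_lattice L" \<phi> \<psi>
    unfolding def ab
    by (intro complete_cxt_pair.intro complete_gorder.intro complete_cxt_pair_axioms.intro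
        complete_lattice_concept_lattice Bmor_in_PiE m)
  let ?CK = "complete_cxt (concept_lattice K)" and ?CL = "complete_cxt (concept_lattice L)"
  have phi_eq: "\<phi> x = (down L (up L (\<alpha> ` fst x)), up L (\<alpha> ` fst x))"
    and psi_eq: "\<psi> x = (down L (\<beta> ` snd x), up L (down L (\<beta> ` snd x)))"
    if "x \<in> concepts K" for x
    using Bmor_simps[OF that] by (simp_all add: def ab)
  have cD: "fst x \<subseteq> obj K" "snd x \<subseteq> att K" "down K (snd x) = fst x" "up K (fst x) = snd x"
    if "x \<in> concepts K" for x
    using conceptD[of "fst x" "snd x" K] that by simp_all
  have cD': "fst x \<subseteq> obj L" "snd x \<subseteq> att L" "down L (snd x) = fst x" "up L (fst x) = snd x"
    if "x \<in> concepts L" for x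
    using conceptD[of "fst x" "snd x" L] that by simp_all
  \<comment> \<open>The lifted value is the closure of an image, so it is tested on generators. The
    preimage of an extent thereby acts as the value of an upper adjoint, and \<open>le_psi\<close>
    is the dual.\<close>
  have phi_le: "\<phi> x \<sqsubseteq>\<^bsub>concept_lattice L\<^esub> y \<longleftrightarrow> fst x \<subseteq> {g \<in> obj K. \<alpha> g \<in> fst y}"
    if x: "x \<in> concepts K" and y: "y \<in> concepts L" for x y
  proof -
    have "\<phi> x \<sqsubseteq>\<^bsub>concept_lattice L\<^esub> y \<longleftrightarrow> \<alpha> ` fst x \<subseteq> fst y"
      using down_up_subset_iff[of "\<alpha> ` fst x" L "snd y"] im(1)[of "fst x"] cD[OF x] cD'[OF y]
      by (simp add: le_concept_lattice phi_eq[OF x])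
    then show ?thesis
      using cD(1)[OF x] by auto
  qed
  have le_psi: "y \<sqsubseteq>\<^bsub>concept_lattice L\<^esub> \<psi> x \<longleftrightarrow> snd x \<subseteq> {m \<in> att K. \<beta> m \<in> snd y}"
    if x: "x \<in> concepts K" and y: "y \<in> concepts L" for x y
  proof -
    have "y \<sqsubseteq>\<^bsub>concept_lattice L\<^esub> \<psi> x \<longleftrightarrow> \<beta> ` snd x \<subseteq> snd y"
      using up_down_subset_iff[of "fst y" L "\<beta> ` snd x"] im(2)[of "snd x"] cD[OF x] cD'[OF y]
        le_concept_lattice_snd[OF y, of "\<psi> x"] psi_closed[of x] x
      by (simp add: psi_eq[OF x])
    then show ?thesis
      using cD(2)[OF x] by auto
  qed
  have Pi: "\<phi> \<in> concepts K \<rightarrow> concepts L" "\<psi> \<in> concepts K \<rightarrow> concepts L"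
    using phi psi by auto
  have sup: "sup_pres (concept_lattice K) (concept_lattice L) \<phi>"
    unfolding sup_pres_phi_iff carrier_concept_lattice
  proof
    fix y assume y: "y \<in> concepts L"
    then have "{g \<in> obj K. \<alpha> g \<in> fst y} \<in> extents K"
      using s by (auto simp: separately_continuous_def extents_eq)
    then obtain z where z: "z \<in> concepts K" "fst z = {g \<in> obj K. \<alpha> g \<in> fst y}"
      by (auto simp: extents_eq)
    show "\<exists>z\<in>concepts K. \<forall>x\<in>concepts K.
        \<phi> x \<sqsubseteq>\<^bsub>concept_lattice L\<^esub> y \<longleftrightarrow> x \<sqsubseteq>\<^bsub>concept_lattice K\<^esub> z"
      by (intro bexI[OF _ z(1)] ballI) (simp add: phi_le[OF _ y], simp add: z(2) le_concept_lattice)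
  qed
  have inf: "inf_pres (concept_lattice K) (concept_lattice L) \<psi>"
    unfolding inf_pres_psi_iff carrier_concept_lattice
  proof
    fix y assume y: "y \<in> concepts L"
    then have "{m \<in> att K. \<beta> m \<in> snd y} \<in> intents K"
      using s by (auto simp: separately_continuous_def intents_eq)
    then obtain z where z: "z \<in> concepts K" "snd z = {m \<in> att K. \<beta> m \<in> snd y}"
      by (auto simp: intents_eq)
    show "\<exists>z\<in>concepts K. \<forall>x\<in>concepts K.
        y \<sqsubseteq>\<^bsub>concept_lattice L\<^esub> \<psi> x \<longleftrightarrow> z \<sqsubseteq>\<^bsub>concept_lattice K\<^esub> x"
      by (intro bexI[OF _ z(1)] ballI) (simp add: le_psi[OF _ y], simp add: z le_concept_lattice_snd)
  qed
  have s': "separately_continuous ?CK ?CL (\<phi>, \<psi>)"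
    using sup inf by (simp add: separately_continuous_iff)
  have cc: "concept_continuous ?CK ?CL (\<phi>, \<psi>)" if "concept_continuous K L f"
    unfolding concept_continuous_iff carrier_concept_lattice
  proof
    fix y assume y: "y \<in> concepts L"
    let ?z = "({g \<in> obj K. \<alpha> g \<in> fst y}, {m \<in> att K. \<beta> m \<in> snd y})"
    have z: "?z \<in> concepts K"
      using that y unfolding concept_continuous_def ab split_beta by simp
    show "\<exists>z\<in>concepts K. \<forall>x\<in>concepts K.
        (\<phi> x \<sqsubseteq>\<^bsub>concept_lattice L\<^esub> y \<longleftrightarrow> x \<sqsubseteq>\<^bsub>concept_lattice K\<^esub> z) \<and>
        (y \<sqsubseteq>\<^bsub>concept_lattice L\<^esub> \<psi> x \<longleftrightarrow> z \<sqsubseteq>\<^bsub>concept_lattice K\<^esub> x)"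
    proof (intro bexI[OF _ z] ballI conjI)
      fix x assume x: "x \<in> concepts K"
      show "\<phi> x \<sqsubseteq>\<^bsub>concept_lattice L\<^esub> y \<longleftrightarrow> x \<sqsubseteq>\<^bsub>concept_lattice K\<^esub> ?z"
        by (subst phi_le[OF x y]) (simp add: le_concept_lattice)
      show "y \<sqsubseteq>\<^bsub>concept_lattice L\<^esub> \<psi> x \<longleftrightarrow> ?z \<sqsubseteq>\<^bsub>concept_lattice K\<^esub> x"
        by (simp add: le_psi[OF x y] le_concept_lattice_snd[OF z x])
    qed
  qed
  have c: "conceptual ?CK ?CL (\<phi>, \<psi>)" if "conceptual K L f"
  proof -
    \<comment> \<open>Conceptuality makes the lower polar of \<beta>[B] and the upper polar of
      \<alpha>[A] one concept, which is both lifted values.\<close>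
    have "\<phi> x = \<psi> x" if x: "x \<in> concepts K" for x
    proof -
      have "(down L (\<beta> ` snd x), up L (\<alpha> ` fst x)) \<in> concepts L"
        using \<open>conceptual K L f\<close> x unfolding conceptual_def ab by (auto simp: split_beta)
      from conceptD[OF this] show ?thesis
        by (simp add: phi_eq psi_eq x)
    qed
    then have "\<phi> = \<psi>"
      using PiE_ext[OF phi psi] by simp
    then show ?thesis
      using sup inf unfolding conceptual_iff by simp
  qed
  have e: "cxt_embedding ?CK ?CL (\<phi>, \<psi>)" if "cxt_embedding K L f"
    unfolding cxt_embedding_iff carrier_concept_lattice
  proof (intro ballI)
    fix x y assume xy: "x \<in> concepts K" "y \<in> concepts K"
    have "\<psi> y \<in> concepts L"
      using psi_closed[of y] xy by simp
    then have "\<phi> x \<sqsubseteq>\<^bsub>concept_lattice L\<^esub> \<psi> y \<longleftrightarrow> fst x \<subseteq> {g \<in> obj K. \<alpha> g \<in> down L (\<beta> ` snd y)}"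
      by (simp add: phi_le xy psi_eq)
    \<comment> \<open>The embedding pulls the polar of the image of an intent back to the polar of
      that intent, which is the extent of \<open>y\<close>.\<close>
    also have "{g \<in> obj K. \<alpha> g \<in> down L (\<beta> ` snd y)} = down K (snd y)"
    proof -
      have "(\<alpha> g, \<beta> m) \<in> inc L \<longleftrightarrow> (g, m) \<in> inc K" "\<alpha> g \<in> obj L" if "g \<in> obj K" "m \<in> snd y" for g m
        using \<open>cxt_embedding K L f\<close> that cD(2)[OF xy(2)] m
        by (auto simp: cxt_embedding_def ab mapping_pairs_def)
      moreover have "\<alpha> g \<in> obj L" if "g \<in> obj K" for g
        using that m by (auto simp: mapping_pairs_def)
      ultimately show ?thesis
        by (auto simp: down_def)
    qed
    finally show "\<phi> x \<sqsubseteq>\<^bsub>concept_lattice L\<^esub> \<psi> y \<longleftrightarrow> x \<sqsubseteq>\<^bsub>concept_lattice K\<^esub> y"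
      by (simp add: le_concept_lattice cD xy)
  qed
  have d: "dense_pair ?CK ?CL (\<phi>, \<psi>)" if "dense_pair K L f"
  proof -
    have "y \<in> \<phi> ` concepts K" if y: "y \<in> concepts L" for y
    proof -
      obtain A where A: "A \<subseteq> obj K" "down L (up L (fst y)) = down L (up L (\<alpha> ` A))"
        using \<open>dense_pair K L f\<close> cD'(1)[OF y] unfolding dense_pair_def extent_dense_def ab by auto
      let ?x = "(down K (up K A), up K A)"
      have x: "?x \<in> concepts K"
        using A(1) by simp
      \<comment> \<open>\<open>A\<close> was replaced by its closure to obtain a concept; separate
        continuity shows that the closure of the image is unchanged.\<close>
      have "fst (\<phi> ?x) = fst y"
        using A separately_continuous_up[OF m s A(1)] cD'[OF y] by (simp add: phi_eq x)
      then have "\<phi> ?x = y"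
        using y phi_closed[of ?x] x by (intro concept_eqI[of _ L]) simp_all
      then show ?thesis
        using x by blast
    qed
    moreover have "y \<in> \<psi> ` concepts K" if y: "y \<in> concepts L" for y
    proof -
      obtain B where B: "B \<subseteq> att K" "up L (down L (snd y)) = up L (down L (\<beta> ` B))"
        using \<open>dense_pair K L f\<close> cD'(2)[OF y] unfolding dense_pair_def intent_dense_def ab by auto
      let ?x = "(down K B, up K (down K B))"
      have x: "?x \<in> concepts K"
        using B(1) by simp
      have "fst (\<psi> ?x) = down L (\<beta> ` B)"
        using separately_continuous_down[OF m s B(1)] by (simp add: psi_eq x)
      also have "\<dots> = fst y"
        using B im(2)[OF B(1)] cD'[OF y] by (metis down_up_down)
      finally have "\<psi> ?x = y"
        using y psi_closed[of ?x] x by (intro concept_eqI[of _ L]) simp_all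
      then show ?thesis
        using x by blast
    qed
    ultimately have "\<phi> ` concepts K = concepts L" "\<psi> ` concepts K = concepts L"
      using Pi by blast+
    then show ?thesis
      using dense_pair_iff[OF sup inf] by simp
  qed
  show ?thesis
    unfolding B using f mapping_pair s' cc c e d by (cases X) auto
qed

section \<open>Unit and counit\<close>

lemma gam_in_concepts: "g \<in> obj K \<Longrightarrow> gam K g \<in> concepts K"
  and mu_in_concepts: "m \<in> att K \<Longrightarrow> mu K m \<in> concepts K"
  by (simp_all add: gam_def mu_def)

text \<open>Together with \<open>le_mu_iff\<close> this turns membership in extents and intents into
  inequalities, the elementwise form of join-density and meet-density.\<close>

lemma gam_le_iff:
  assumes "g \<in> obj K" "z \<in> concepts K"
  shows "gam K g \<sqsubseteq>\<^bsub>concept_lattice K\<^esub> z \<longleftrightarrow> g \<in> fst z"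
  using down_up_subset_iff[of "{g}" K "snd z"] conceptD[of "fst z" "snd z" K] assms
  by (simp add: le_concept_lattice gam_def)

lemma le_mu_iff:
  assumes "m \<in> att K" "z \<in> concepts K"
  shows "z \<sqsubseteq>\<^bsub>concept_lattice K\<^esub> mu K m \<longleftrightarrow> m \<in> snd z"
  using up_down_subset_iff[of "fst z" K "{m}"] conceptD[of "fst z" "snd z" K] assms
    mu_in_concepts[OF assms(1)]
  by (simp add: le_concept_lattice_snd mu_def)

lemma eta_in_cxt_hom: "eta K \<in> cxt_hom X K (complete_cxt (concept_lattice K))"
proof -
  interpret L: complete_gorder "concept_lattice K"
    by (intro complete_gorder.intro complete_lattice_concept_lattice)
  let ?C = "complete_cxt (concept_lattice K)" and ?cut = "principal_cut (concept_lattice K)"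
  obtain \<alpha> \<beta> where ab: "eta K = (\<alpha>, \<beta>)"
    by fastforce
  have eta: "\<And>g. g \<in> obj K \<Longrightarrow> \<alpha> g = gam K g" "\<And>m. m \<in> att K \<Longrightarrow> \<beta> m = mu K m"
    using ab by (auto simp: eta_def)
  have cD: "fst x \<subseteq> obj K" "snd x \<subseteq> att K" if "x \<in> concepts K" for x
    using conceptD[of "fst x" "snd x" K] that by simp_all
  have m: "(\<alpha>, \<beta>) \<in> mapping_pairs K ?C"
    unfolding ab[symmetric] by (auto simp: eta_def mapping_pairs_def gam_in_concepts mu_in_concepts)
  \<comment> \<open>A concept is the join of the object concepts from its extent and the meet of the
    attribute concepts from its intent.\<close>
  have up: "up ?C (\<alpha> ` fst x) = snd (?cut x)" and down: "down ?C (\<beta> ` snd x) = fst (?cut x)"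
    if x: "x \<in> concepts K" for x
  proof -
    have "(\<forall>g\<in>fst x. \<alpha> g \<in> concepts K \<and> \<alpha> g \<sqsubseteq>\<^bsub>concept_lattice K\<^esub> z) \<longleftrightarrow> x \<sqsubseteq>\<^bsub>concept_lattice K\<^esub> z"
      if "z \<in> concepts K" for z
      unfolding le_concept_lattice[of _ x]
      using that cD(1)[OF x] by (auto simp: subset_iff eta gam_in_concepts gam_le_iff)
    then show "up ?C (\<alpha> ` fst x) = snd (?cut x)"
      by (simp add: up_def principal_cut_def cong: conj_cong)
    have "(\<forall>m\<in>snd x. \<beta> m \<in> concepts K \<and> z \<sqsubseteq>\<^bsub>concept_lattice K\<^esub> \<beta> m) \<longleftrightarrow> z \<sqsubseteq>\<^bsub>concept_lattice K\<^esub> x"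
      if "z \<in> concepts K" for z
      unfolding le_concept_lattice_snd[OF that x]
      using that cD(2)[OF x] by (auto simp: subset_iff eta mu_in_concepts le_mu_iff)
    then show "down ?C (\<beta> ` snd x) = fst (?cut x)"
      by (simp add: down_def principal_cut_def cong: conj_cong)
  qed
  have cc: "concept_continuous K ?C (\<alpha>, \<beta>)"
  proof -
    \<comment> \<open>The object concepts below \<open>x\<close> are those of the objects in its
      extent, and dually, so pulling the cut at \<open>x\<close> back along the unit returns
      \<open>x\<close>.\<close>
    have "({g \<in> obj K. \<alpha> g \<in> fst (?cut x)}, {m \<in> att K. \<beta> m \<in> snd (?cut x)}) = x"
      if x: "x \<in> concepts K" for x
      using x cD[OF x]
      by (auto simp: principal_cut_def eta gam_le_iff le_mu_iff gam_in_concepts mu_in_concepts prod_eq_iff)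
    then show ?thesis
      unfolding concept_continuous_def L.concepts_complete_cxt by (auto simp: split_beta)
  qed
  note s = concept_continuous_imp_separately_continuous[OF cc]
  \<comment> \<open>An object concept lies below \<open>mu K m\<close> exactly if the object is in
    \<open>down K {m}\<close>.\<close>
  have e: "cxt_embedding K ?C (\<alpha>, \<beta>)"
    by (auto simp: cxt_embedding_def eta gam_in_concepts mu_in_concepts gam_le_iff)
      (auto simp: mu_def down_def)
  have c: "conceptual K ?C (\<alpha>, \<beta>)"
    using s L.concepts_complete_cxt by (auto simp: conceptual_def down[of "(_, _)", simplified] up[of "(_, _)", simplified])
  \<comment> \<open>The witness is the extent of the join of \<open>S\<close>: its object concepts
    have the same upper bounds as \<open>S\<close>.\<close>
  have "\<exists>A\<subseteq>obj K. down ?C (up ?C S) = down ?C (up ?C (\<alpha> ` A))" if "S \<subseteq> concepts K" for S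
  proof -
    have "\<Squnion>\<^bsub>concept_lattice K\<^esub>S \<in> concepts K"
      using L.sup_closed[of S] that by simp
    then have "up ?C S = up ?C (\<alpha> ` fst (\<Squnion>\<^bsub>concept_lattice K\<^esub>S))"
      using L.down_up_complete_cxt(1)[of S] that by (simp add: up)
    then show ?thesis
      using cD(1)[OF \<open>\<Squnion>\<^bsub>concept_lattice K\<^esub>S \<in> concepts K\<close>] by auto
  qed
  moreover have "\<exists>B\<subseteq>att K. up ?C (down ?C S) = up ?C (down ?C (\<beta> ` B))" if "S \<subseteq> concepts K" for S
  proof -
    have "\<Sqinter>\<^bsub>concept_lattice K\<^esub>S \<in> concepts K"
      using L.inf_closed[of S] that by simp
    then have "down ?C S = down ?C (\<beta> ` snd (\<Sqinter>\<^bsub>concept_lattice K\<^esub>S))"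
      using L.up_down_complete_cxt(1)[of S] that by (simp add: down)
    then show ?thesis
      using cD(2)[OF \<open>\<Sqinter>\<^bsub>concept_lattice K\<^esub>S \<in> concepts K\<close>] by auto
  qed
  ultimately have d: "dense_pair K ?C (\<alpha>, \<beta>)"
    by (simp add: dense_pair_def extent_dense_def intent_dense_def)
  show ?thesis
    unfolding ab using m cc s e c d by (cases X) auto
qed

text \<open>The extent of an object concept is the closure of a singleton, and closing a set before
  mapping it does not change the closure of its image.\<close>

lemma eta_natural:
  assumes "f \<in> cxt_hom X K L"
  shows "cxt_comp K (Bmor K L f) (eta K) = cxt_comp K (eta L) f"
proof -
  obtain \<alpha> \<beta> where ab: "f = (\<alpha>, \<beta>)"
    by fastforce
  have m: "(\<alpha>, \<beta>) \<in> mapping_pairs K L" and s: "separately_continuous K L (\<alpha>, \<beta>)"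
    using cxt_hom_imp_Cjm[OF assms] by (auto simp: ab)
  have mem: "\<And>g. g \<in> obj K \<Longrightarrow> \<alpha> g \<in> obj L" "\<And>m. m \<in> att K \<Longrightarrow> \<beta> m \<in> att L"
    using m by (auto simp: mapping_pairs_def)
  have "fst (Bmor K L f) (gam K g) = gam L (\<alpha> g)" if "g \<in> obj K" for g
    using that separately_continuous_up[OF m s, of "{g}"]
    by (simp add: ab Bmor_simps gam_in_concepts) (simp add: gam_def)
  moreover have "snd (Bmor K L f) (mu K m) = mu L (\<beta> m)" if "m \<in> att K" for m
    using that separately_continuous_down[OF m s, of "{m}"]
    by (simp add: ab Bmor_simps mu_in_concepts) (simp add: mu_def)
  ultimately show ?thesis
    using mem by (auto simp: cxt_comp_def eta_def ab compose_def restrict_def fun_eq_iff)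
qed

text \<open>The cancellation law behind the later equations. Membership in \<open>X\<close> is
  weakened to \<open>Cjm\<close>, where completeness of the target turns continuity into
  preservation of joins and meets.\<close>

lemma cxt_hom_eqI:
  assumes L: "complete_lattice L"
    and h: "h \<in> cxt_hom X (complete_cxt (concept_lattice K)) (complete_cxt L)"
    and h': "h' \<in> cxt_hom X (complete_cxt (concept_lattice K)) (complete_cxt L)"
    and eq: "cxt_comp K h (eta K) = cxt_comp K h' (eta K)"
  shows "h = h'"
proof -
  interpret L: complete_gorder L
    by (intro complete_gorder.intro L)
  \<comment> \<open>Values are joins over object concepts and meets over attribute concepts. The
    form with a test element \<open>y\<close> follows from the residuation criteria alone.\<close>
  have le_iff: "fst k \<in> concepts K \<rightarrow>\<^sub>E carrier L \<and> snd k \<in> concepts K \<rightarrow>\<^sub>E carrier L \<and>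
      (\<forall>x\<in>concepts K. \<forall>y\<in>carrier L.
        (fst k x \<sqsubseteq>\<^bsub>L\<^esub> y \<longleftrightarrow> (\<forall>g\<in>fst x. fst k (gam K g) \<sqsubseteq>\<^bsub>L\<^esub> y)) \<and>
        (y \<sqsubseteq>\<^bsub>L\<^esub> snd k x \<longleftrightarrow> (\<forall>m\<in>snd x. y \<sqsubseteq>\<^bsub>L\<^esub> snd k (mu K m))))"
    if "k \<in> cxt_hom X (complete_cxt (concept_lattice K)) (complete_cxt L)" for k
  proof -
    obtain \<phi> \<psi> where k: "k = (\<phi>, \<psi>)"
      by fastforce
    have hom: "(\<phi>, \<psi>) \<in> cxt_hom Cjm (complete_cxt (concept_lattice K)) (complete_cxt L)"
      using cxt_hom_imp_Cjm[OF that] k by simp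
    then interpret complete_cxt_pair "concept_lattice K" L \<phi> \<psi>
      by (intro complete_cxt_pair.intro complete_gorder.intro complete_cxt_pair_axioms.intro
        complete_lattice_concept_lattice L) (auto simp: mapping_pairs_complete_cxt)
    have sp: "sup_pres (concept_lattice K) L \<phi>" "inf_pres (concept_lattice K) L \<psi>"
      using hom separately_continuous_iff by auto
    note sup = bspec[OF sp(1)[unfolded sup_pres_phi_iff carrier_concept_lattice]]
    note inf = bspec[OF sp(2)[unfolded inf_pres_psi_iff carrier_concept_lattice]]
    have "\<phi> x \<sqsubseteq>\<^bsub>L\<^esub> y \<longleftrightarrow> (\<forall>g\<in>fst x. \<phi> (gam K g) \<sqsubseteq>\<^bsub>L\<^esub> y)"
      and "y \<sqsubseteq>\<^bsub>L\<^esub> \<psi> x \<longleftrightarrow> (\<forall>m\<in>snd x. y \<sqsubseteq>\<^bsub>L\<^esub> \<psi> (mu K m))"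
      if x: "x \<in> concepts K" and y: "y \<in> carrier L" for x y
    proof -
      have sub: "\<And>g. g \<in> fst x \<Longrightarrow> g \<in> obj K" "\<And>m. m \<in> snd x \<Longrightarrow> m \<in> att K"
        using conceptD[of "fst x" "snd x" K] x by auto
      obtain z where z: "z \<in> concepts K" "\<forall>x\<in>concepts K. \<phi> x \<sqsubseteq>\<^bsub>L\<^esub> y \<longleftrightarrow> x \<sqsubseteq>\<^bsub>concept_lattice K\<^esub> z"
        using sup[OF y] by (elim bexE)
      have "\<phi> (gam K g) \<sqsubseteq>\<^bsub>L\<^esub> y \<longleftrightarrow> g \<in> fst z" if "g \<in> fst x" for g
        using z sub(1)[OF that] by (simp add: gam_in_concepts gam_le_iff)
      then show "\<phi> x \<sqsubseteq>\<^bsub>L\<^esub> y \<longleftrightarrow> (\<forall>g\<in>fst x. \<phi> (gam K g) \<sqsubseteq>\<^bsub>L\<^esub> y)"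
        using z(2) x by (auto simp: le_concept_lattice)
      obtain w where w: "w \<in> concepts K" "\<forall>x\<in>concepts K. y \<sqsubseteq>\<^bsub>L\<^esub> \<psi> x \<longleftrightarrow> w \<sqsubseteq>\<^bsub>concept_lattice K\<^esub> x"
        using inf[OF y] by (elim bexE)
      have "y \<sqsubseteq>\<^bsub>L\<^esub> \<psi> (mu K m) \<longleftrightarrow> m \<in> snd w" if "m \<in> snd x" for m
        using w sub(2)[OF that] by (simp add: mu_in_concepts le_mu_iff)
      then show "y \<sqsubseteq>\<^bsub>L\<^esub> \<psi> x \<longleftrightarrow> (\<forall>m\<in>snd x. y \<sqsubseteq>\<^bsub>L\<^esub> \<psi> (mu K m))"
        using w x by (auto simp: le_concept_lattice_snd)
    qed
    then show ?thesis
      using phi psi by (simp add: k)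
  qed
  have gam: "fst h (gam K g) = fst h' (gam K g)" if "g \<in> obj K" for g
    using fun_cong[OF arg_cong[OF eq, of fst], of g] that by (simp add: cxt_comp_def eta_def compose_def)
  have mu: "snd h (mu K m) = snd h' (mu K m)" if "m \<in> att K" for m
    using fun_cong[OF arg_cong[OF eq, of snd], of m] that by (simp add: cxt_comp_def eta_def compose_def)
  note l = le_iff[OF h] and l' = le_iff[OF h']
  have pi: "fst h \<in> concepts K \<rightarrow>\<^sub>E carrier L" "snd h \<in> concepts K \<rightarrow>\<^sub>E carrier L"
    "fst h' \<in> concepts K \<rightarrow>\<^sub>E carrier L" "snd h' \<in> concepts K \<rightarrow>\<^sub>E carrier L"
    using l l' by simp_all
  have "fst h x = fst h' x" "snd h x = snd h' x" if x: "x \<in> concepts K" for x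
  proof -
    have sub: "\<And>g. g \<in> fst x \<Longrightarrow> g \<in> obj K" "\<And>m. m \<in> snd x \<Longrightarrow> m \<in> att K"
      using conceptD[of "fst x" "snd x" K] x by auto
    have "fst h x \<sqsubseteq>\<^bsub>L\<^esub> y \<longleftrightarrow> fst h' x \<sqsubseteq>\<^bsub>L\<^esub> y" if "y \<in> carrier L" for y
      using l l' x that gam sub(1) by simp
    then show "fst h x = fst h' x"
      using L.eq_iff_le_iff(1)[OF pi(1,3)[THEN PiE_mem, OF x]] by simp
    have "y \<sqsubseteq>\<^bsub>L\<^esub> snd h x \<longleftrightarrow> y \<sqsubseteq>\<^bsub>L\<^esub> snd h' x" if "y \<in> carrier L" for y
      using l l' x that mu sub(2) by simp
    then show "snd h x = snd h' x"
      using L.eq_iff_le_iff(2)[OF pi(2,4)[THEN PiE_mem, OF x]] by simp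
  qed
  then have "fst h = fst h'" "snd h = snd h'"
    by (auto intro: PiE_ext[OF pi(1,3)] PiE_ext[OF pi(2,4)])
  then show ?thesis
    by (rule prod_eqI)
qed

section \<open>Category laws for extensional pairs\<close>

lemma cxt_comp_assoc:
  assumes "f \<in> mapping_pairs K K'"
  shows "cxt_comp K h (cxt_comp K g f) = cxt_comp K (cxt_comp K' h g) f"
  using assms by (auto simp: cxt_comp_def mapping_pairs_def compose_def restrict_def fun_eq_iff)

lemma cxt_comp_id:
  assumes "f \<in> mapping_pairs K L"
  shows "cxt_comp K (cxt_id L) f = f" "cxt_comp K f (cxt_id K) = f"
proof -
  have "restrict (fst f) (obj K) = fst f" "restrict (snd f) (att K) = snd f"
    using assms by (auto simp: mapping_pairs_def intro: PiE_restrict)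
  moreover have "\<And>g. g \<in> obj K \<Longrightarrow> fst f g \<in> obj L" "\<And>m. m \<in> att K \<Longrightarrow> snd f m \<in> att L"
    using assms by (auto simp: mapping_pairs_def)
  ultimately show "cxt_comp K (cxt_id L) f = f" "cxt_comp K f (cxt_id K) = f"
    by (simp_all add: cxt_comp_def cxt_id_def compose_def prod_eq_iff cong: restrict_cong)
qed

lemma cxt_hom_imp_mapping_pairs: "f \<in> cxt_hom X K L \<Longrightarrow> f \<in> mapping_pairs K L"
  by (cases X) auto

text \<open>Identities and composites on the lattice side are those of the complete contexts, so
  only the hom-sets have to be compared.\<close>

lemma lat_id_eq: "lat_id L = cxt_id (complete_cxt L)"
  and lat_comp_eq: "lat_comp L h' h = cxt_comp (complete_cxt L) h' h"
  by (simp_all add: lat_id_def cxt_id_def lat_comp_def cxt_comp_def)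

definition concept_join :: "'a gorder \<Rightarrow> 'a set \<times> 'a set \<Rightarrow> 'a"
  where "concept_join L = (\<lambda>c\<in>concepts (complete_cxt L). \<Squnion>\<^bsub>L\<^esub>(fst c))"

section \<open>The counit and the universal property of the unit\<close>

context complete_gorder
begin

abbreviation "C \<equiv> complete_cxt L"
abbreviation "BC \<equiv> concept_lattice C"
abbreviation "CBC \<equiv> complete_cxt BC"
abbreviation "eps \<equiv> pair_hom (concept_join L)"

lemma principal_cut_in_concepts [simp]: "x \<in> carrier L \<Longrightarrow> principal_cut L x \<in> concepts C"
  by (simp add: concepts_complete_cxt)

lemma concept_join_principal_cut [simp]:
  assumes "x \<in> carrier L"
  shows "concept_join L (principal_cut L x) = x"
proof -
  have "\<Squnion>(fst (principal_cut L x)) = x"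
    using assms by (intro le_antisym sup_least sup_upper sup_closed) (auto simp: principal_cut_def)
  then show ?thesis
    using assms by (simp add: concept_join_def)
qed

lemma principal_cut_le_iff:
  assumes "x \<in> carrier L" "y \<in> carrier L"
  shows "principal_cut L x \<sqsubseteq>\<^bsub>BC\<^esub> principal_cut L y \<longleftrightarrow> x \<sqsubseteq> y"
  using assms le_refl le_trans by (auto simp: le_concept_lattice principal_cut_def)

lemma concept_join_lattice_iso: "concept_join L \<in> lattice_isos BC L"
proof -
  interpret BC: partial_order BC
    by (rule partial_order_concept_lattice)
  have "concept_join L \<in> concepts C \<rightarrow>\<^sub>E carrier L"
    by (intro PiE_I) (auto simp: concepts_complete_cxt concept_join_def principal_cut_def intro!: sup_closed)
  moreover have "bij_betw (concept_join L) (concepts C) (carrier L)"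
    by (rule bij_betwI[where g = "principal_cut L"]) (auto simp: concepts_complete_cxt)
  moreover have "order_emb BC L (concept_join L)"
    using weak_partial_order_axioms BC.weak_partial_order_axioms
    by (auto simp: order_emb_def concepts_complete_cxt principal_cut_le_iff)
  ultimately show ?thesis
    by (simp add: lattice_isos_def)
qed

lemma eps_in_cxt_hom: "eps \<in> cxt_hom X CBC C"
proof -
  interpret e: complete_cxt_pair BC L "concept_join L" "concept_join L"
    using concept_join_lattice_iso
    by (intro complete_cxt_pair.intro complete_gorder.intro complete_cxt_pair_axioms.intro
        complete_lattice_concept_lattice complete_lattice_axioms)
      (auto simp: lattice_isos_def)
  show ?thesis
    unfolding pair_hom_def by (intro e.lattice_iso_imp_cxt_hom concept_join_lattice_iso HOL.refl)
qed

lemma eps_eta: "cxt_comp C eps (eta C) = cxt_id C"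
  by (auto simp: cxt_comp_def eta_def cxt_id_def compose_def pair_hom_def restrict_def fun_eq_iff
      gam_complete_cxt mu_complete_cxt)

lemma eta_eps: "cxt_comp CBC (eta C) eps = cxt_id CBC"
  by (auto simp: cxt_comp_def eta_def cxt_id_def compose_def pair_hom_def restrict_def fun_eq_iff
      gam_complete_cxt mu_complete_cxt concepts_complete_cxt)

text \<open>Existence for the definite description comes from \<open>eps\<close>, uniqueness from
  cancelling the unit; the value is the same for all paired \<open>Y\<close>.\<close>

lemma counit_eq:
  assumes "(X, Y) \<in> paired_cats"
  shows "counit Y L = eps"
  unfolding counit_def Cmor_def
    lat_hom_eq_cxt_hom[OF assms complete_lattice_concept_lattice complete_lattice_axioms]
proof (rule the_equality)
  show "eps \<in> cxt_hom X CBC C \<and> cxt_comp C eps (eta C) = cxt_id C"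
    using eps_in_cxt_hom eps_eta by simp
  show "e = eps" if "e \<in> cxt_hom X CBC C \<and> cxt_comp C e (eta C) = cxt_id C" for e
    using that eps_eta by (intro cxt_hom_eqI[OF complete_lattice_axioms _ eps_in_cxt_hom]) auto
qed

lemma ex1_extension_along_eta:
  assumes f: "f \<in> cxt_hom X K C"
  shows "\<exists>!h. h \<in> cxt_hom X (complete_cxt (concept_lattice K)) C \<and> cxt_comp K h (eta K) = f"
proof (rule ex_ex1I)
  \<comment> \<open>The usual transpose under an adjunction: lift \<open>f\<close>, then apply the
    counit.\<close>
  let ?h = "cxt_comp (complete_cxt (concept_lattice K)) eps (Bmor K C f)"
  have "cxt_comp K ?h (eta K) = cxt_comp K eps (cxt_comp K (Bmor K C f) (eta K))"
    by (rule cxt_comp_assoc[symmetric, OF cxt_hom_imp_mapping_pairs[OF eta_in_cxt_hom]])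
  also have "\<dots> = cxt_comp K eps (cxt_comp K (eta C) f)"
    by (simp only: eta_natural[OF f])
  also have "\<dots> = cxt_comp K (cxt_comp C eps (eta C)) f"
    by (rule cxt_comp_assoc[OF cxt_hom_imp_mapping_pairs[OF f]])
  also have "\<dots> = f"
    by (simp only: eps_eta cxt_comp_id[OF cxt_hom_imp_mapping_pairs[OF f]])
  finally have "cxt_comp K ?h (eta K) = f" .
  then show "\<exists>h. h \<in> cxt_hom X (complete_cxt (concept_lattice K)) C \<and> cxt_comp K h (eta K) = f"
    using cxt_comp_in_hom[OF Bmor_in_cxt_hom[OF f] eps_in_cxt_hom] by blast
qed (use cxt_hom_eqI[OF complete_lattice_axioms] in blast)

end

lemma Bmor_id: "Bmor K K (cxt_id K) = cxt_id (complete_cxt (concept_lattice K))"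
  (is "_ = cxt_id ?C")
proof (rule cxt_hom_eqI[OF complete_lattice_concept_lattice])
  \<comment> \<open>An equation between pairs does not depend on the category, so the largest one,
    \<open>Cjm\<close>, serves.\<close>
  note e = cxt_hom_imp_mapping_pairs[OF eta_in_cxt_hom[where X = Cjm and K = K]]
  show "Bmor K K (cxt_id K) \<in> cxt_hom Cjm ?C ?C" "cxt_id ?C \<in> cxt_hom Cjm ?C ?C"
    by (intro Bmor_in_cxt_hom cxt_id_in_hom)+
  show "cxt_comp K (Bmor K K (cxt_id K)) (eta K) = cxt_comp K (cxt_id ?C) (eta K)"
    unfolding eta_natural[OF cxt_id_in_hom[where X = Cjm]] by (simp only: cxt_comp_id[OF e])
qed

lemma Bmor_comp:
  assumes f: "f \<in> cxt_hom X K K'" and f': "f' \<in> cxt_hom X K' K''"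
  shows "Bmor K K'' (cxt_comp K f' f) =
    cxt_comp (complete_cxt (concept_lattice K)) (Bmor K' K'' f') (Bmor K K' f)"
    (is "_ = cxt_comp ?C _ _")
proof (rule cxt_hom_eqI[OF complete_lattice_concept_lattice])
  show "Bmor K K'' (cxt_comp K f' f) \<in> cxt_hom X ?C (complete_cxt (concept_lattice K''))"
    by (intro Bmor_in_cxt_hom cxt_comp_in_hom[OF f f'])
  show "cxt_comp ?C (Bmor K' K'' f') (Bmor K K' f) \<in> cxt_hom X ?C (complete_cxt (concept_lattice K''))"
    by (intro cxt_comp_in_hom[OF Bmor_in_cxt_hom[OF f] Bmor_in_cxt_hom[OF f']])
  note m = cxt_hom_imp_mapping_pairs[OF f]
    and e = cxt_hom_imp_mapping_pairs[OF eta_in_cxt_hom]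
  have "cxt_comp K (Bmor K K'' (cxt_comp K f' f)) (eta K) = cxt_comp K (eta K'') (cxt_comp K f' f)"
    by (rule eta_natural[OF cxt_comp_in_hom[OF f f']])
  also have "\<dots> = cxt_comp K (cxt_comp K' (Bmor K' K'' f') (eta K')) f"
    by (simp only: cxt_comp_assoc[OF m] eta_natural[OF f'])
  also have "\<dots> = cxt_comp K (cxt_comp ?C (Bmor K' K'' f') (Bmor K K' f)) (eta K)"
    by (simp only: cxt_comp_assoc[OF m, symmetric] cxt_comp_assoc[OF e, symmetric] eta_natural[OF f])
  finally show "cxt_comp K (Bmor K K'' (cxt_comp K f' f)) (eta K) =
    cxt_comp K (cxt_comp ?C (Bmor K' K'' f') (Bmor K K' f)) (eta K)" .
qed

theorem theorem5p1:
  fixes K :: "('g, 'm) cxt" and K' :: "('h, 'n) cxt" and K'' :: "('k, 'o) cxt"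
    and L :: "'a gorder" and L' :: "'b gorder" and L'' :: "'c gorder"
    and X :: cxt_cat and Y :: lat_cat
  assumes cases: "(X, Y) \<in> {(Cjm, CLjm), (Cc, CLc), (Ccd, CLcd), (Cce, CLce), (Cde, CLis),
      (Ccc, CLc_low), (Ccc, CLc_up), (Cccd, CLc_low_d), (Cccd, CLc_up_d),
      (Ccce, CLc_low_e), (Ccce, CLc_up_e)}"
    and "is_cxt K" and "is_cxt K'" and "is_cxt K''"
    and "complete_lattice L" and "complete_lattice L'" and "complete_lattice L''"
  shows "
    \<comment> \<open>\<open>X\<close> and \<open>Y\<close> are categories\<close>
    (cxt_id K \<in> cxt_hom X K K)
    \<and> (\<forall>f\<in>cxt_hom X K K'. \<forall>f'\<in>cxt_hom X K' K''. cxt_comp K f' f \<in> cxt_hom X K K'')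
    \<and> (lat_id L \<in> lat_hom Y L L)
    \<and> (\<forall>h\<in>lat_hom Y L L'. \<forall>h'\<in>lat_hom Y L' L''. lat_comp L h' h \<in> lat_hom Y L L'')
    \<comment> \<open>\<open>\<B>\<close> is a functor from \<open>X\<close> to \<open>Y\<close>\<close>
    \<and> (complete_lattice (concept_lattice K))
    \<and> (\<forall>f\<in>cxt_hom X K K'. Bmor K K' f \<in> lat_hom Y (concept_lattice K) (concept_lattice K'))
    \<and> (Bmor K K (cxt_id K) = lat_id (concept_lattice K))
    \<and> (\<forall>f\<in>cxt_hom X K K'. \<forall>f'\<in>cxt_hom X K' K''.
      Bmor K K'' (cxt_comp K f' f) =
        lat_comp (concept_lattice K) (Bmor K' K'' f') (Bmor K K' f))
    \<comment> \<open>\<open>\<C>\<close> is a functor from \<open>Y\<close> to \<open>X\<close>\<close>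
    \<and> (is_cxt (complete_cxt L))
    \<and> (\<forall>h\<in>lat_hom Y L L'. Cmor h \<in> cxt_hom X (complete_cxt L) (complete_cxt L'))
    \<and> (Cmor (lat_id L) = cxt_id (complete_cxt L))
    \<and> (\<forall>h\<in>lat_hom Y L L'. \<forall>h'\<in>lat_hom Y L' L''.
      Cmor (lat_comp L h' h) = cxt_comp (complete_cxt L) (Cmor h') (Cmor h))
    \<comment> \<open>\<open>\<eta>\<close> is a natural transformation from the identity to \<open>\<C>\<B>\<close>\<close>
    \<and> (eta K \<in> cxt_hom X K (complete_cxt (concept_lattice K)))
    \<and> (\<forall>f\<in>cxt_hom X K K'. cxt_comp K (Cmor (Bmor K K' f)) (eta K) = cxt_comp K (eta K') f)
    \<comment> \<open>\<open>\<B>\<close> is left adjoint to \<open>\<C>\<close> with unit \<open>\<eta>\<close>\<close>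
    \<and> (\<forall>f\<in>cxt_hom X K (complete_cxt L).
      \<exists>!h. h \<in> lat_hom Y (concept_lattice K) L \<and> cxt_comp K (Cmor h) (eta K) = f)
    \<comment> \<open>the counit: triangle identities, naturality, and invertibility in \<open>Y\<close>\<close>
    \<and> (cxt_comp (complete_cxt L) (Cmor (counit Y L)) (eta (complete_cxt L)) =
      cxt_id (complete_cxt L))
    \<and> (lat_comp (concept_lattice K) (counit Y (concept_lattice K))
        (Bmor K (complete_cxt (concept_lattice K)) (eta K)) = lat_id (concept_lattice K))
    \<and> (\<forall>h\<in>lat_hom Y L L'.
      lat_comp (concept_lattice (complete_cxt L)) (counit Y L')
          (Bmor (complete_cxt L) (complete_cxt L') (Cmor h)) =
        lat_comp (concept_lattice (complete_cxt L)) h (counit Y L))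
    \<and> (lat_cat_iso Y (concept_lattice (complete_cxt L)) L (counit Y L))"
proof -
  have XY: "(X, Y) \<in> paired_cats"
    using cases by (simp add: paired_cats_def)
  interpret L: complete_gorder L
    by (rule complete_gorder.intro) fact
  interpret L': complete_gorder L'
    by (rule complete_gorder.intro) fact
  \<comment> \<open>The second triangle identity involves the counit at the concept lattice of
    \<open>K\<close> itself.\<close>
  interpret BK: complete_gorder "concept_lattice K"
    by (rule complete_gorder.intro complete_lattice_concept_lattice)+
  note lattices = \<open>complete_lattice L\<close> \<open>complete_lattice L'\<close> \<open>complete_lattice L''\<close>
    complete_lattice_concept_lattice
  note hom = lat_hom_eq_cxt_hom[OF XY]
  note counits = L.counit_eq[OF XY] L'.counit_eq[OF XY] BK.counit_eq[OF XY]
  note mp = cxt_hom_imp_mapping_pairs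
  have cxt: "is_cxt (complete_cxt L)"
    by (auto simp: is_cxt_def)
  \<comment> \<open>Both sides are compared along \<open>eta K\<close>: naturality of the unit at
    its own component reduces the claim to the first triangle identity for the concept
    lattice.\<close>
  have triangle: "cxt_comp (complete_cxt (concept_lattice K)) BK.eps
      (Bmor K (complete_cxt (concept_lattice K)) (eta K)) = cxt_id (complete_cxt (concept_lattice K))"
  proof (rule cxt_hom_eqI[OF complete_lattice_concept_lattice])
    note e = eta_in_cxt_hom[where K = K and X = X]
    show "cxt_comp (complete_cxt (concept_lattice K)) BK.eps
        (Bmor K (complete_cxt (concept_lattice K)) (eta K)) \<in> cxt_hom X BK.C BK.C"
      by (intro cxt_comp_in_hom[OF Bmor_in_cxt_hom[OF e] BK.eps_in_cxt_hom])
    show "cxt_id BK.C \<in> cxt_hom X BK.C BK.C"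
      by (rule cxt_id_in_hom)
    show "cxt_comp K (cxt_comp BK.C BK.eps (Bmor K BK.C (eta K))) (eta K) =
        cxt_comp K (cxt_id BK.C) (eta K)"
      by (simp only: cxt_comp_assoc[OF mp[OF e], symmetric] eta_natural[OF e])
        (simp only: cxt_comp_assoc[OF mp[OF e]] BK.eps_eta)
  qed
  \<comment> \<open>Precomposed with the unit of \<open>L.C\<close>, both sides become
    \<open>h\<close>.\<close>
  have natural: "cxt_comp L.CBC L'.eps (Bmor L.C L'.C h) = cxt_comp L.CBC h L.eps"
    if h: "h \<in> cxt_hom X L.C L'.C" for h
  proof (rule cxt_hom_eqI[OF \<open>complete_lattice L'\<close>])
    note e = eta_in_cxt_hom[where K = L.C and X = X]
    show "cxt_comp L.CBC L'.eps (Bmor L.C L'.C h) \<in> cxt_hom X L.CBC L'.C"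
      by (intro cxt_comp_in_hom[OF Bmor_in_cxt_hom[OF h] L'.eps_in_cxt_hom])
    show "cxt_comp L.CBC h L.eps \<in> cxt_hom X L.CBC L'.C"
      by (intro cxt_comp_in_hom[OF L.eps_in_cxt_hom h])
    have "cxt_comp L.C (cxt_comp L.CBC L'.eps (Bmor L.C L'.C h)) (eta L.C) = h"
      by (simp only: cxt_comp_assoc[OF mp[OF e], symmetric] eta_natural[OF h])
        (simp only: cxt_comp_assoc[OF mp[OF h]] L'.eps_eta cxt_comp_id[OF mp[OF h]])
    also have "h = cxt_comp L.C (cxt_comp L.CBC h L.eps) (eta L.C)"
      by (simp only: cxt_comp_assoc[OF mp[OF e], symmetric] L.eps_eta cxt_comp_id[OF mp[OF h]])
    finally show "cxt_comp L.C (cxt_comp L.CBC L'.eps (Bmor L.C L'.C h)) (eta L.C) =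
        cxt_comp L.C (cxt_comp L.CBC h L.eps) (eta L.C)" .
  qed
  \<comment> \<open>The inverse is the unit of the complete context, which belongs to every
    hom-set.\<close>
  have iso: "lat_cat_iso Y L.BC L L.eps"
    unfolding lat_cat_iso_def lat_id_eq lat_comp_eq hom[OF lattices(4,1)] hom[OF lattices(1,4)]
    by (intro conjI bexI[of _ "eta L.C"] L.eps_in_cxt_hom L.eta_eps L.eps_eta eta_in_cxt_hom)
  show ?thesis
    \<comment> \<open>All claims move to the context side, where \<open>Cmor\<close> disappears and
      its functoriality becomes reflexivity.\<close>
    unfolding counits lat_id_eq lat_comp_eq Cmor_def hom[OF lattices(1,1)] hom[OF lattices(1,2)]
      hom[OF lattices(2,3)] hom[OF lattices(1,3)] hom[OF lattices(4,4)] hom[OF lattices(4,1)]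
    by (intro conjI ballI cxt_id_in_hom complete_lattice_concept_lattice Bmor_in_cxt_hom Bmor_id
        eta_in_cxt_hom L.eps_eta triangle iso cxt L.ex1_extension_along_eta HOL.refl)
      (auto intro: cxt_comp_in_hom Bmor_comp eta_natural natural)
qed

end
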